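(* Let $\Gamma$ be a dense subgroup of $\mathrm{SL}_2(\mathbb{R})$, treated as a discrete group. Then the locally compact group $G=\mathbb{R}^2\rtimes\Gamma$ is not QSIN.
   Context: Density of $\Gamma$ is with respect to the usual topology of $\mathrm{SL}_2(\mathbb{R})$. The group $\Gamma$ acts on $\mathbb{R}^2$ by matrix multiplication, and $G=\mathbb{R}^2\rtimes\Gamma$ is the corresponding semidirect product, with the product of the usual topology on $\mathbb{R}^2$ and the discrete topology on $\Gamma$ (so $\mathbb{R}^2$ is an open normal subgroup). A locally compact group $G$ is QSIN (quasi-small invariant neighbourhood) if $\mathrm{L}^1(G)$ admits a bounded approximate identity $(e_\alpha)$ which is asymptotically invariant under inner automorphisms, i.e. $\|\delta_s*e_\alpha*\delta_{s^{-1}}-e_\alpha\|_1\to 0$ for each $s\in G$, where $\delta_s$ is the point mass at $s$. *)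

theory Defs
  imports "HOL-Probability.Probability" "HOL-Algebra.Group"
begin

section \<open>Locally compact groups and their Haar measures\<close>

definition locally_compact_group :: "('a, 'b) monoid_scheme \<Rightarrow> 'a topology \<Rightarrow> bool" where
  "locally_compact_group G T \<longleftrightarrow>
     group G \<and> topspace T = carrier G \<and>
     continuous_map (prod_topology T T) T (\<lambda>(x, y). x \<otimes>\<^bsub>G\<^esub> y) \<and>
     continuous_map T T (\<lambda>x. inv\<^bsub>G\<^esub> x) \<and>
     Hausdorff_space T \<and> locally_compact_space T"

definition borel_sets_of :: "'a topology \<Rightarrow> 'a set set" where
  "borel_sets_of T = sigma_sets (topspace T) {U. openin T U}"

text \<open>Left Haar measures are non-zero left invariant Radon measures. The regularity conditions are
  outer regularity on all Borel sets and inner regularity on open sets. They matter here because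
  the group need not be \<sigma>-compact.\<close>

definition left_haar_measure :: "('a, 'b) monoid_scheme \<Rightarrow> 'a topology \<Rightarrow> 'a measure \<Rightarrow> bool" where
  "left_haar_measure G T M \<longleftrightarrow>
     space M = topspace T \<and> sets M = borel_sets_of T \<and>
     emeasure M (space M) \<noteq> 0 \<and>
     (\<forall>K. compactin T K \<longrightarrow> emeasure M K < \<infinity>) \<and>
     (\<forall>A\<in>sets M. emeasure M A = (INF U\<in>{U. openin T U \<and> A \<subseteq> U}. emeasure M U)) \<and>
     (\<forall>U. openin T U \<longrightarrow>
        emeasure M U = (SUP K\<in>{K. compactin T K \<and> K \<in> sets M \<and> K \<subseteq> U}. emeasure M K)) \<and>
     (\<forall>s\<in>carrier G. \<forall>A\<in>sets M. emeasure M ((\<lambda>x. s \<otimes>\<^bsub>G\<^esub> x) ` A) = emeasure M A)"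

definition modular_function :: "('a, 'b) monoid_scheme \<Rightarrow> 'a measure \<Rightarrow> 'a \<Rightarrow> real" where
  "modular_function G M s =
     (THE c. c > 0 \<and> (\<forall>A\<in>sets M. emeasure M ((\<lambda>x. x \<otimes>\<^bsub>G\<^esub> s) ` A) = ennreal c * emeasure M A))"


section \<open>The convolution algebra \<open>L\<^sup>1(G)\<close>\<close>

text \<open>Elements of \<open>L\<^sup>1(G)\<close> are represented by Borel measurable functions, which are not identified
  when they agree almost everywhere; all notions below depend only on the class.\<close>

definition L1 :: "'a measure \<Rightarrow> ('a \<Rightarrow> complex) set" where
  "L1 M = {f. integrable M f}"

text \<open>The norm is a Lebesgue integral with values in \<open>[0, \<infinity>]\<close>, since the Bochner integral
  of a non-integrable function would be \<open>0\<close>.\<close>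

definition L1_norm :: "'a measure \<Rightarrow> ('a \<Rightarrow> complex) \<Rightarrow> ennreal" where
  "L1_norm M f = (\<integral>\<^sup>+x. ennreal (norm (f x)) \<partial>M)"

definition convol ::
  "('a, 'b) monoid_scheme \<Rightarrow> 'a measure \<Rightarrow> ('a \<Rightarrow> complex) \<Rightarrow> ('a \<Rightarrow> complex) \<Rightarrow> 'a \<Rightarrow> complex" where
  "convol G M f g x = (\<integral>y. f y * g (inv\<^bsub>G\<^esub> y \<otimes>\<^bsub>G\<^esub> x) \<partial>M)"

text \<open>Convolution of a finite measure \<open>\<nu>\<close> with a function in \<open>L\<^sup>1(G)\<close>, on either side. The modular
  function of the left Haar measure \<open>M\<close> enters on the right, so that both agree
  with the convolution of the measures \<open>\<nu>\<close> and \<open>f \<sqdot> M\<close>.\<close>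

definition convol_measure_left ::
  "('a, 'b) monoid_scheme \<Rightarrow> 'a measure \<Rightarrow> ('a \<Rightarrow> complex) \<Rightarrow> 'a \<Rightarrow> complex" where
  "convol_measure_left G \<nu> f x = (\<integral>y. f (inv\<^bsub>G\<^esub> y \<otimes>\<^bsub>G\<^esub> x) \<partial>\<nu>)"

definition convol_measure_right ::
  "('a, 'b) monoid_scheme \<Rightarrow> 'a measure \<Rightarrow> ('a \<Rightarrow> complex) \<Rightarrow> 'a measure \<Rightarrow> 'a \<Rightarrow> complex" where
  "convol_measure_right G M f \<nu> x =
     (\<integral>y. f (x \<otimes>\<^bsub>G\<^esub> inv\<^bsub>G\<^esub> y) * complex_of_real (modular_function G M (inv\<^bsub>G\<^esub> y)) \<partial>\<nu>)"


section \<open>QSIN groups\<close>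

text \<open>A net is a family \<open>e\<close> together with a proper filter \<open>F\<close> on its index type (for a directed
  index set, the filter generated by its tails).\<close>

definition bounded_approximate_identity ::
  "('a, 'b) monoid_scheme \<Rightarrow> 'a measure \<Rightarrow> ('i \<Rightarrow> 'a \<Rightarrow> complex) \<Rightarrow> 'i filter \<Rightarrow> bool" where
  "bounded_approximate_identity G M e F \<longleftrightarrow>
     F \<noteq> bot \<and>
     (\<forall>i. e i \<in> L1 M) \<and> (\<exists>C::real. \<forall>i. L1_norm M (e i) \<le> ennreal C) \<and>
     (\<forall>f\<in>L1 M. ((\<lambda>i. L1_norm M (\<lambda>x. convol G M (e i) f x - f x)) \<longlongrightarrow> 0) F \<and>
                ((\<lambda>i. L1_norm M (\<lambda>x. convol G M f (e i) x - f x)) \<longlongrightarrow> 0) F)"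

definition asymptotically_inner_invariant ::
  "('a, 'b) monoid_scheme \<Rightarrow> 'a measure \<Rightarrow> ('i \<Rightarrow> 'a \<Rightarrow> complex) \<Rightarrow> 'i filter \<Rightarrow> bool" where
  "asymptotically_inner_invariant G M e F \<longleftrightarrow>
     (\<forall>s\<in>carrier G.
        ((\<lambda>i. L1_norm M (\<lambda>x.
            convol_measure_left G (return M s)
              (convol_measure_right G M (e i) (return M (inv\<^bsub>G\<^esub> s))) x - e i x)) \<longlongrightarrow> 0) F)"

text \<open>The left Haar measure is unique up to a positive factor, on which the property does not
  depend. Fixing the index type is no restriction, as \<open>qsinI\<close> shows.\<close>

definition qsin :: "('a, 'b) monoid_scheme \<Rightarrow> 'a topology \<Rightarrow> bool" where
  "qsin G T \<longleftrightarrow>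
     (\<exists>M (e :: ('a \<Rightarrow> complex) \<Rightarrow> 'a \<Rightarrow> complex) F.
        left_haar_measure G T M \<and> bounded_approximate_identity G M e F \<and>
        asymptotically_inner_invariant G M e F)"

lemma qsinI:
  fixes e :: "'i \<Rightarrow> 'a \<Rightarrow> complex"
  assumes "left_haar_measure G T M" "bounded_approximate_identity G M e F"
    "asymptotically_inner_invariant G M e F"
  shows "qsin G T"
proof -
  define d where "d = (\<lambda>h. if h \<in> range e then h else e undefined)"
  have d: "d (e i) = e i" for i by (simp add: d_def)
  have r: "\<exists>i. d h = e i" for h by (auto simp: d_def)
  have b: "bounded_approximate_identity G M d (filtermap e F)"
    using assms(2) r unfolding bounded_approximate_identity_def
    by (simp add: filtermap_bot_iff filterlim_filtermap d) metis
  have a: "asymptotically_inner_invariant G M d (filtermap e F)"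
    using assms(3) unfolding asymptotically_inner_invariant_def
    by (simp add: filterlim_filtermap d)
  show ?thesis unfolding qsin_def using assms(1) a b by blast
qed


section \<open>The group \<open>\<real>\<^sup>2 \<rtimes> \<Gamma>\<close>\<close>

definition SL2 :: "(real^2^2) monoid" where
  "SL2 = \<lparr>carrier = {A. det A = 1}, mult = (**), one = mat 1\<rparr>"

definition affine_group :: "(real^2^2) set \<Rightarrow> ((real^2) \<times> (real^2^2)) monoid" where
  "affine_group \<Gamma> =
     \<lparr>carrier = UNIV \<times> \<Gamma>, mult = (\<lambda>(x, A) (y, B). (x + A *v y, A ** B)), one = (0, mat 1)\<rparr>"

definition affine_topology :: "(real^2^2) set \<Rightarrow> ((real^2) \<times> (real^2^2)) topology" where
  "affine_topology \<Gamma> = prod_topology euclidean (discrete_topology \<Gamma>)"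

lemma group_SL2: "group SL2"
proof (rule groupI)
  fix A assume "A \<in> carrier SL2"
  then have A: "det A = 1" by (simp add: SL2_def)
  then have "invertible A" by (simp add: invertible_det_nz)
  then obtain B where "B ** A = mat 1" by (auto simp: invertible_def)
  moreover from this have "det B = 1" using A by (metis det_mul det_I mult.right_neutral)
  ultimately show "\<exists>B\<in>carrier SL2. B \<otimes>\<^bsub>SL2\<^esub> A = \<one>\<^bsub>SL2\<^esub>" by (auto simp: SL2_def)
qed (auto simp: SL2_def det_mul matrix_mul_assoc)

lemma locally_compact_group_affine:
  assumes "subgroup \<Gamma> SL2"
  shows "locally_compact_group (affine_group \<Gamma>) (affine_topology \<Gamma>)"
proof -
  interpret S: group SL2 by (rule group_SL2)
  interpret H: subgroup \<Gamma> SL2 by fact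
  have mul: "A ** B \<in> \<Gamma>" if "A \<in> \<Gamma>" "B \<in> \<Gamma>" for A B
    using H.m_closed[OF that] by (simp add: SL2_def)
  have one: "mat 1 \<in> \<Gamma>" using H.one_closed by (simp add: SL2_def)
  have inv: "\<exists>B\<in>\<Gamma>. B ** A = mat 1" if "A \<in> \<Gamma>" for A
    using H.m_inv_closed[OF that] S.l_inv[OF H.mem_carrier[OF that]] by (auto simp: SL2_def)
  have G: "group (affine_group \<Gamma>)"
  proof (rule groupI)
    fix p assume "p \<in> carrier (affine_group \<Gamma>)"
    then obtain x A where p: "p = (x, A)" "A \<in> \<Gamma>" by (auto simp: affine_group_def)
    obtain B where B: "B \<in> \<Gamma>" "B ** A = mat 1" using inv p by blast
    then show "\<exists>q\<in>carrier (affine_group \<Gamma>). q \<otimes>\<^bsub>affine_group \<Gamma>\<^esub> p = \<one>\<^bsub>affine_group \<Gamma>\<^esub>"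
      by (intro bexI[of _ "(- (B *v x), B)"]) (use p B in \<open>auto simp: affine_group_def\<close>)
  qed (auto simp: affine_group_def mul one matrix_mul_assoc matrix_vector_mul_assoc
        matrix_vector_right_distrib)
  interpret G: group "affine_group \<Gamma>" by (rule G)
  define J where "J A = (SOME B. B \<in> \<Gamma> \<and> B ** A = mat 1)" for A
  have J: "J A \<in> \<Gamma>" "J A ** A = mat 1" if "A \<in> \<Gamma>" for A
    using inv[OF that] someI_ex[of "\<lambda>B. B \<in> \<Gamma> \<and> B ** A = mat 1"] by (auto simp: J_def)
  have invG: "inv\<^bsub>affine_group \<Gamma>\<^esub> (x, A) = (- (J A *v x), J A)" if "A \<in> \<Gamma>" for x A
    by (rule G.inv_equality) (use that J in \<open>auto simp: affine_group_def\<close>)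
  let ?T = "affine_topology \<Gamma>"
  have open_iff: "openin ?T U \<longleftrightarrow> U \<subseteq> UNIV \<times> \<Gamma> \<and> (\<forall>A\<in>\<Gamma>. open {x. (x, A) \<in> U})" for U
  proof
    assume U: "openin ?T U"
    have "open {x. (x, A) \<in> U}" if "A \<in> \<Gamma>" for A
    proof -
      have "continuous_map euclidean ?T (\<lambda>x. (x, A))"
        unfolding affine_topology_def using that by (auto intro!: continuous_map_pairedI)
      from openin_continuous_map_preimage[OF this U] show ?thesis by simp
    qed
    moreover have "U \<subseteq> UNIV \<times> \<Gamma>"
      using openin_subset[OF U] by (simp add: affine_topology_def)
    ultimately show "U \<subseteq> UNIV \<times> \<Gamma> \<and> (\<forall>A\<in>\<Gamma>. open {x. (x, A) \<in> U})" by blast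
  next
    assume U: "U \<subseteq> UNIV \<times> \<Gamma> \<and> (\<forall>A\<in>\<Gamma>. open {x. (x, A) \<in> U})"
    then have "U = (\<Union>A\<in>\<Gamma>. {x. (x, A) \<in> U} \<times> {A})" by auto
    moreover have "openin ?T (\<Union>A\<in>\<Gamma>. {x. (x, A) \<in> U} \<times> {A})"
      unfolding affine_topology_def using U by (intro openin_Union) (auto simp: openin_prod_Times_iff)
    ultimately show "openin ?T U" by simp
  qed
  have top: "topspace ?T = UNIV \<times> \<Gamma>" by (simp add: affine_topology_def)
  have contI: "continuous_map ?T ?T f"
    if h: "\<And>A. A \<in> \<Gamma> \<Longrightarrow> h A \<in> \<Gamma>" and f: "\<And>x A. A \<in> \<Gamma> \<Longrightarrow> f (x, A) = (g A x, h A)"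
      and g: "\<And>A. A \<in> \<Gamma> \<Longrightarrow> continuous_on UNIV (g A)" for f g h
    unfolding continuous_map_def
  proof (intro conjI allI impI)
    show "f \<in> topspace ?T \<rightarrow> topspace ?T" using that by (auto simp: top)
    fix U assume "openin ?T U"
    then have U: "\<And>A. A \<in> \<Gamma> \<Longrightarrow> open {x. (x, A) \<in> U}" by (simp add: open_iff)
    have "open {x. f (x, A) \<in> U}" if A: "A \<in> \<Gamma>" for A
    proof -
      have "open (g A -` {x. (x, h A) \<in> U})"
        by (intro open_vimage U h g A)
      then show ?thesis using A f by (simp add: vimage_def)
    qed
    then show "openin ?T {p \<in> topspace ?T. f p \<in> U}" by (auto simp: open_iff top)
  qed
  have "continuous_map ?T ?T (\<lambda>p. inv\<^bsub>affine_group \<Gamma>\<^esub> p)"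
    by (rule contI[of J _ "\<lambda>A x. - (J A *v x)"])
      (auto simp: J invG intro!: continuous_intros matrix_vector_mult_linear_continuous_on)
  moreover have "continuous_map (prod_topology ?T ?T) ?T (\<lambda>(p, q). p \<otimes>\<^bsub>affine_group \<Gamma>\<^esub> q)"
    unfolding continuous_map_def
  proof (intro conjI allI impI)
    show "(\<lambda>(p, q). p \<otimes>\<^bsub>affine_group \<Gamma>\<^esub> q) \<in> topspace (prod_topology ?T ?T) \<rightarrow> topspace ?T"
      by (auto simp: top affine_group_def mul)
    fix U assume "openin ?T U"
    then have U: "\<And>A. A \<in> \<Gamma> \<Longrightarrow> open {x. (x, A) \<in> U}" by (simp add: open_iff)
    show "openin (prod_topology ?T ?T)
        {r \<in> topspace (prod_topology ?T ?T). (case r of (p, q) \<Rightarrow> p \<otimes>\<^bsub>affine_group \<Gamma>\<^esub> q) \<in> U}"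
      (is "openin _ ?V")
      unfolding openin_prod_topology_alt
    proof (intro allI impI)
      fix p q assume "(p, q) \<in> ?V"
      then obtain x A y B where pq: "p = (x, A)" "q = (y, B)" "A \<in> \<Gamma>" "B \<in> \<Gamma>"
        "(x + A *v y, A ** B) \<in> U" by (auto simp: top affine_group_def)
      have "open ((\<lambda>z. fst z + A *v snd z) -` {w. (w, A ** B) \<in> U})"
        using U[OF mul[OF pq(3,4)]]
        by (intro open_vimage)
           (auto intro!: continuous_intros matrix_vector_mult_linear_continuous_on
                 continuous_on_compose2[OF matrix_vector_mult_linear_continuous_on[of UNIV A]])
      then obtain P Q where PQ: "open P" "open Q" "x \<in> P" "y \<in> Q"
        "P \<times> Q \<subseteq> (\<lambda>z. fst z + A *v snd z) -` {w. (w, A ** B) \<in> U}"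
        using pq(5) by (elim open_prod_elim[of _ "(x, y)"]) auto
      have *: "open {z. z \<in> S \<and> C}" if "open S" for S :: "(real^2) set" and C
        by (cases C) (use that in auto)
      show "\<exists>P Q. openin ?T P \<and> openin ?T Q \<and> p \<in> P \<and> q \<in> Q \<and> P \<times> Q \<subseteq> ?V"
        using PQ pq by (intro exI[of _ "P \<times> {A}"] exI[of _ "Q \<times> {B}"])
          (auto simp: open_iff top affine_group_def intro!: *)
    qed
  qed
  moreover have "Hausdorff_space ?T"
    by (simp add: affine_topology_def Hausdorff_space_prod_topology)
  moreover have "locally_compact_space (discrete_topology \<Gamma>)"
    unfolding locally_compact_space_def
    by (metis compactin_sing insertI1 openin_discrete_topology order_refl singletonD subsetI
        topspace_discrete_topology)
  then have "locally_compact_space ?T"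
    by (simp add: affine_topology_def locally_compact_space_prod_topology
        locally_compact_space_euclidean)
  moreover have "topspace ?T = carrier (affine_group \<Gamma>)" by (simp add: top affine_group_def)
  ultimately show ?thesis using G unfolding locally_compact_group_def by blast
qed

end

theory Submission
  imports Defs
begin

text \<open>
  Suppose that \<open>(e\<^sub>i)\<close> is a bounded approximate identity that is asymptotically invariant under inner
  automorphisms, and let \<open>\<phi>\<^sub>i\<close> be the restriction of \<open>e\<^sub>i\<close> to the open normal subgroup \<open>\<real>\<^sup>2\<close>. Conjugation
  by \<open>(0, A)\<close> acts on \<open>\<real>\<^sup>2\<close> as the matrix \<open>A\<close>, so \<open>\<phi>\<^sub>i \<circ> A - \<phi>\<^sub>i\<close> tends to zero in \<open>L\<^sup>1(\<real>\<^sup>2)\<close> for every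
  \<open>A \<in> \<Gamma>\<close> (\<open>displacement_le\<close>).

  Such almost invariant functions must lose their mass, because a dense subgroup of \<open>SL\<^sub>2(\<real>)\<close> preserves
  no probability measure on the projective line. Quantitatively, a hyperbolic matrix moves everything
  outside a narrow cone around its contracting axis into a narrow cone around its expanding axis, so
  almost all the mass of an almost invariant density lies in these two cones. By density \<open>\<Gamma>\<close> contains
  two hyperbolic matrices with disjoint pairs of cones, one close to \<open>diag(4, 1/4)\<close> and one close to its
  conjugate by the rotation by \<open>\<pi>/4\<close>. Hence twice the mass of \<open>|\<phi>\<^sub>i|\<close> is at most the mass plus two
  errors that tend to zero (\<open>mass_le_two_hyperbolic_displacements\<close>), and the mass tends to zero.

  On the other hand, the convolution of \<open>e\<^sub>i\<close> with the indicator function of the unit box of \<open>\<real>\<^sup>2\<close>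
  involves, on \<open>\<real>\<^sup>2\<close>, only \<open>\<phi>\<^sub>i\<close>. It converges to that indicator function, so the mass of \<open>|\<phi>\<^sub>i|\<close> cannot
  tend to zero (\<open>haar_const_le_approximation\<close>).

  Since Haar measure is given abstractly, it has to be identified first: on each fibre \<open>\<real>\<^sup>2 \<times> {A}\<close> it is
  the same multiple of Lebesgue measure (\<open>emeasure_fibre\<close>). As \<open>\<Gamma>\<close> consists of matrices of determinant
  one, it is also right invariant, so the modular function is \<open>1\<close> (\<open>modular_function_1\<close>).
\<close>

section \<open>Translation invariant measures on Euclidean space\<close>

text \<open>Uniqueness of Haar measure, in the form needed here. With \<open>\<lambda>\<close> for Lebesgue measure, the
  double integral of \<open>1\<^sub>A(x) 1\<^sub>B(y - x)\<close> equals \<open>\<mu>(A) \<lambda>(B)\<close> when \<open>y\<close> is integrated first; integrating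
  over \<open>x\<close> first, after the shift \<open>x \<mapsto> x + y\<close>, gives \<open>\<mu>(-B) \<lambda>(A)\<close>. Taking \<open>-B\<close> to be the unit box
  compares the two measures.\<close>

lemma translation_invariant_eq_scaled_lborel:
  fixes \<mu> :: "'a::euclidean_space measure"
  assumes sets: "sets \<mu> = sets borel"
    and fin: "\<And>K. compact K \<Longrightarrow> emeasure \<mu> K < \<infinity>"
    and inv: "\<And>v. distr \<mu> borel ((+) v) = \<mu>"
  shows "\<mu> = scale_measure (emeasure \<mu> (cbox 0 One)) lborel"
proof (rule measure_eqI)
  show "sets \<mu> = sets (scale_measure (emeasure \<mu> (cbox 0 One)) lborel)"
    by (simp add: sets)
  fix A assume "A \<in> sets \<mu>"
  then have A[measurable]: "A \<in> sets borel" by (simp add: sets)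
  have [measurable_cong, simp]: "sets \<mu> = sets borel" by (rule sets)
  interpret \<mu>: sigma_finite_measure \<mu>
  proof
    have "space \<mu> = UNIV" using sets_eq_imp_space_eq[OF sets] by simp
    then show "\<exists>C. countable C \<and> C \<subseteq> sets \<mu> \<and> \<Union>C = space \<mu> \<and> (\<forall>a\<in>C. emeasure \<mu> a \<noteq> \<infinity>)"
      using fin[OF compact_cball]
      by (intro exI[of _ "range (\<lambda>n. cball 0 (real n))"])
         (auto simp: less_top intro: real_arch_simple)
  qed
  interpret pair_sigma_finite \<mu> "lborel :: 'a measure" ..
  let ?Q = "cbox 0 One :: 'a set"
  define B where "B = cbox (- One) (0 :: 'a)"
  have B[measurable]: "B \<in> sets borel" by (simp add: B_def)
  have BQ: "indicator B (- x) = (indicator ?Q x :: ennreal)" for x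
    by (auto simp: B_def indicator_def mem_box)
  have lB: "emeasure lborel B = 1"
    by (simp add: B_def emeasure_lborel_cbox_eq)
  have trans: "(\<integral>\<^sup>+x. f (y + x) \<partial>\<mu>) = (\<integral>\<^sup>+x. f x \<partial>\<mu>)"
    if [measurable]: "f \<in> borel_measurable borel" for f :: "'a \<Rightarrow> ennreal" and y
  proof -
    have "(\<integral>\<^sup>+x. f x \<partial>\<mu>) = (\<integral>\<^sup>+x. f x \<partial>distr \<mu> borel ((+) y))" by (simp only: inv)
    also have "\<dots> = (\<integral>\<^sup>+x. f (y + x) \<partial>\<mu>)" by (rule nn_integral_distr) auto
    finally show ?thesis ..
  qed
  have ltrans: "(\<integral>\<^sup>+x. f (x + y) \<partial>lborel) = (\<integral>\<^sup>+x. f x \<partial>lborel)"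
    if [measurable]: "f \<in> borel_measurable borel" for f :: "'a \<Rightarrow> ennreal" and y
  proof -
    have "(\<integral>\<^sup>+x. f x \<partial>lborel) = (\<integral>\<^sup>+x. f x \<partial>distr lborel borel ((+) y))"
      by (simp only: lborel_distr_plus)
    also have "\<dots> = (\<integral>\<^sup>+x. f (y + x) \<partial>lborel)" by (rule nn_integral_distr) auto
    finally show ?thesis by (simp add: add.commute)
  qed
  have "emeasure \<mu> A = (\<integral>\<^sup>+x. indicator A x * (\<integral>\<^sup>+y. indicator B y \<partial>lborel) \<partial>\<mu>)"
    by (simp add: lB)
  also have "\<dots> = (\<integral>\<^sup>+x. indicator A x * (\<integral>\<^sup>+y. indicator B (y + - x) \<partial>lborel) \<partial>\<mu>)"
    by (subst ltrans) auto
  also have "\<dots> = (\<integral>\<^sup>+x. (\<integral>\<^sup>+y. indicator A x * indicator B (y - x) \<partial>lborel) \<partial>\<mu>)"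
    by (subst nn_integral_cmult) auto
  also have "\<dots> = (\<integral>\<^sup>+y. (\<integral>\<^sup>+x. indicator A x * indicator B (y - x) \<partial>\<mu>) \<partial>lborel)"
    by (rule Fubini'[symmetric]) measurable
  also have "\<dots> = (\<integral>\<^sup>+y. (\<integral>\<^sup>+x. indicator A (y + x) * indicator B (y - (y + x)) \<partial>\<mu>) \<partial>lborel)"
    by (intro nn_integral_cong trans[symmetric]) auto
  also have "\<dots> = (\<integral>\<^sup>+y. (\<integral>\<^sup>+x. indicator ?Q x * indicator A (y + x) \<partial>\<mu>) \<partial>lborel)"
    by (simp add: BQ mult.commute)
  also have "\<dots> = (\<integral>\<^sup>+x. (\<integral>\<^sup>+y. indicator ?Q x * indicator A (y + x) \<partial>lborel) \<partial>\<mu>)"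
    by (rule Fubini') measurable
  also have "\<dots> = (\<integral>\<^sup>+x. indicator ?Q x * (\<integral>\<^sup>+y. indicator A (y + x) \<partial>lborel) \<partial>\<mu>)"
    by (subst nn_integral_cmult) auto
  also have "\<dots> = emeasure \<mu> ?Q * emeasure lborel A"
    by (subst ltrans) (auto simp: nn_integral_multc)
  finally show "emeasure \<mu> A = emeasure (scale_measure (emeasure \<mu> ?Q) lborel) A"
    by simp
qed

text \<open>The image measure is again translation invariant, so only its value on the unit box has to be
  computed; there the change of variables formula for measurable sets of finite measure applies.\<close>

lemma distr_lborel_unimodular:
  fixes A :: "real^'n::{finite,wellorder}^'n::_"
  assumes det: "\<bar>det A\<bar> = 1"
  shows "distr lborel borel ((*v) A) = lborel"
proof -
  from det have "invertible A" by (auto simp: invertible_det_nz)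
  then obtain B where AB: "A ** B = mat 1" and BA: "B ** A = mat 1" by (auto simp: invertible_def)
  have ABv[simp]: "A *v (B *v x) = x" "B *v (A *v x) = x" for x
    by (simp_all add: matrix_vector_mul_assoc AB BA)
  have meas[measurable]: "(*v) C \<in> borel_measurable borel" for C :: "real^'n::{finite,wellorder}^'n::_"
    by (intro borel_measurable_continuous_onI matrix_vector_mult_linear_continuous_on)
  have "det A * det B = 1" by (metis AB det_mul det_I)
  with det have detB: "\<bar>det B\<bar> = 1" by (metis abs_mult abs_one mult_1)
  have vim: "(*v) A -` S = (*v) B ` S" for S
    by (auto simp: image_iff) (metis ABv)
  let ?\<mu> = "distr lborel borel ((*v) A)"
  have "?\<mu> = scale_measure (emeasure ?\<mu> (cbox 0 One)) lborel"
  proof (rule translation_invariant_eq_scaled_lborel)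
    show "emeasure ?\<mu> K < \<infinity>" if "compact K" for K
    proof -
      have "compact ((*v) B ` K)"
        by (intro compact_continuous_image that matrix_vector_mult_linear_continuous_on)
      then show ?thesis
        using that emeasure_compact_finite by (subst emeasure_distr) (auto simp: vim compact_imp_closed)
    qed
    show "distr ?\<mu> borel ((+) v) = ?\<mu>" for v
    proof -
      have "distr ?\<mu> borel ((+) v) = distr lborel borel (\<lambda>x. v + A *v x)"
        by (subst distr_distr) (auto simp: o_def)
      also have "\<dots> = distr lborel borel (\<lambda>x. A *v (B *v v + x))"
        by (simp add: matrix_vector_right_distrib)
      also have "\<dots> = distr (distr lborel borel ((+) (B *v v))) borel ((*v) A)"
        by (subst distr_distr) (auto simp: o_def)
      finally show ?thesis by (simp add: lborel_distr_plus)
    qed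
  qed simp
  moreover have "emeasure ?\<mu> (cbox 0 One) = 1"
  proof -
    let ?Q = "cbox 0 One :: (real^'n::{finite,wellorder}) set"
    have c: "compact ((*v) B ` ?Q)"
      by (intro compact_continuous_image compact_cbox matrix_vector_mult_linear_continuous_on)
    have "emeasure ?\<mu> ?Q = emeasure lborel ((*v) B ` ?Q)"
      by (subst emeasure_distr) (auto simp: vim)
    also have "\<dots> = ennreal (measure lborel ((*v) B ` ?Q))"
      using c emeasure_compact_finite[OF c] by (intro emeasure_eq_ennreal_measure) auto
    also have "measure lborel ((*v) B ` ?Q) = measure lebesgue ((*v) B ` ?Q)"
      using c by (simp add: measure_completion compact_imp_closed)
    also have "\<dots> = measure lebesgue ?Q"
      by (simp add: measure_linear_image detB)
    also have "\<dots> = 1" by (simp add: content_cbox_if  measure_completion)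
    finally show ?thesis by simp
  qed
  ultimately show ?thesis by simp
qed

lemma emeasure_lborel_translation:
  fixes S :: "'a::euclidean_space set"
  assumes "S \<in> sets borel"
  shows "emeasure lborel ((+) a ` S) = emeasure lborel S"
proof -
  have "(+) a ` S = (+) (- a) -` S"
    by (force simp: image_iff intro: exI[of _ "- a + _"])
  then have "emeasure lborel ((+) a ` S) = emeasure (distr lborel borel ((+) (- a))) S"
    using assms by (simp add: emeasure_distr)
  then show ?thesis by (simp only: lborel_distr_plus)
qed

lemma norm_integral_le_nn_integral:
  fixes g :: "'a \<Rightarrow> 'b::{banach, second_countable_topology}"
  shows "ennreal (norm (integral\<^sup>L M g)) \<le> (\<integral>\<^sup>+x. norm (g x) \<partial>M)"
  by (cases "integrable M g") (auto simp: integral_norm_bound_ennreal not_integrable_integral_eq)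

section \<open>Almost invariant functions on the plane and hyperbolic matrices\<close>

text \<open>The mass outside the repelling set \<open>P\<close> is moved by \<open>A\<close> into the attracting set \<open>Q\<close>, up to an
  error measuring how far \<open>|\<phi>|\<close> is from being \<open>A\<close>-invariant. The origin is exempt because it is a
  fixed point and a null set.\<close>

lemma mass_le_repelling_attracting:
  fixes A :: "real^'n::{finite,wellorder}^'n::_" and \<phi> :: "real^'n::{finite,wellorder} \<Rightarrow> complex"
  assumes det: "\<bar>det A\<bar> = 1"
    and [measurable]: "\<phi> \<in> borel_measurable borel" "P \<in> sets borel" "Q \<in> sets borel"
    and maps: "\<And>v. v \<noteq> 0 \<Longrightarrow> v \<notin> P \<Longrightarrow> A *v v \<in> Q"
  shows "(\<integral>\<^sup>+v. norm (\<phi> v) \<partial>lborel) \<le>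
     (\<integral>\<^sup>+v. indicator P v * ennreal (norm (\<phi> v)) \<partial>lborel) + (\<integral>\<^sup>+v. indicator Q v * ennreal (norm (\<phi> v)) \<partial>lborel)
     + (\<integral>\<^sup>+v. norm (\<phi> (A *v v) - \<phi> v) \<partial>lborel)"
proof -
  have [measurable]: "(*v) A \<in> borel_measurable borel"
    by (intro borel_measurable_continuous_onI matrix_vector_mult_linear_continuous_on)
  have sub: "(\<integral>\<^sup>+v. indicator Q v * ennreal (norm (\<phi> v)) \<partial>lborel)
      = (\<integral>\<^sup>+v. indicator Q (A *v v) * ennreal (norm (\<phi> (A *v v))) \<partial>lborel)"
    by (subst distr_lborel_unimodular[OF det, symmetric], subst nn_integral_distr) auto
  have pt: "ennreal (norm (\<phi> v)) \<le> indicator P v * ennreal (norm (\<phi> v))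
      + indicator Q (A *v v) * ennreal (norm (\<phi> (A *v v))) + norm (\<phi> (A *v v) - \<phi> v)" if "v \<noteq> 0" for v
  proof (cases "v \<in> P")
    case False
    have "norm (\<phi> v) \<le> norm (\<phi> (A *v v)) + norm (\<phi> (A *v v) - \<phi> v)"
      by (metis norm_minus_commute norm_triangle_sub)
    then show ?thesis using maps[OF that False] False
      by (simp flip: ennreal_plus)
  qed (simp add: add.assoc)
  have "AE v in lborel. v \<noteq> (0 :: real^'n::{finite,wellorder})"
    by (rule AE_I[of _ _ "{0}"]) auto
  then have "AE v in lborel. ennreal (norm (\<phi> v)) \<le> indicator P v * ennreal (norm (\<phi> v))
      + indicator Q (A *v v) * ennreal (norm (\<phi> (A *v v))) + norm (\<phi> (A *v v) - \<phi> v)"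
    using pt by (rule eventually_mono)
  then have "(\<integral>\<^sup>+v. norm (\<phi> v) \<partial>lborel) \<le> (\<integral>\<^sup>+v. indicator P v * ennreal (norm (\<phi> v))
      + indicator Q (A *v v) * ennreal (norm (\<phi> (A *v v))) + norm (\<phi> (A *v v) - \<phi> v) \<partial>lborel)"
    by (rule nn_integral_mono_AE)
  also have "\<dots> = (\<integral>\<^sup>+v. indicator P v * ennreal (norm (\<phi> v)) \<partial>lborel)
      + (\<integral>\<^sup>+v. indicator Q (A *v v) * ennreal (norm (\<phi> (A *v v))) \<partial>lborel)
      + (\<integral>\<^sup>+v. norm (\<phi> (A *v v) - \<phi> v) \<partial>lborel)"
    by (subst nn_integral_add; (subst nn_integral_add)?) measurable
  finally show ?thesis by (simp only: sub)
qed

text \<open>The paradox behind the theorem: each of the disjoint sets \<open>P \<union> Q\<close> and \<open>P' \<union> Q'\<close> carries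
  almost all of the mass of \<open>|\<phi>|\<close>, so twice the mass is at most the mass plus the two errors.\<close>

lemma mass_le_two_displacements:
  fixes A A' :: "real^'n::{finite,wellorder}^'n::_" and \<phi> :: "real^'n::{finite,wellorder} \<Rightarrow> complex"
  assumes det: "\<bar>det A\<bar> = 1" "\<bar>det A'\<bar> = 1"
    and [measurable]: "\<phi> \<in> borel_measurable borel"
    and fin: "(\<integral>\<^sup>+v. norm (\<phi> v) \<partial>lborel) < \<infinity>"
    and [measurable]: "P \<in> sets borel" "Q \<in> sets borel" "P' \<in> sets borel" "Q' \<in> sets borel"
    and disj: "P \<inter> Q = {}" "P' \<inter> Q' = {}" "(P \<union> Q) \<inter> (P' \<union> Q') = {}"
    and maps: "\<And>v. v \<noteq> 0 \<Longrightarrow> v \<notin> P \<Longrightarrow> A *v v \<in> Q" "\<And>v. v \<noteq> 0 \<Longrightarrow> v \<notin> P' \<Longrightarrow> A' *v v \<in> Q'"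
  shows "(\<integral>\<^sup>+v. norm (\<phi> v) \<partial>lborel) \<le>
     (\<integral>\<^sup>+v. norm (\<phi> (A *v v) - \<phi> v) \<partial>lborel) + (\<integral>\<^sup>+v. norm (\<phi> (A' *v v) - \<phi> v) \<partial>lborel)"
    (is "?c \<le> ?d + ?d'")
proof -
  define m where "m S = (\<integral>\<^sup>+v. indicator S v * ennreal (norm (\<phi> v)) \<partial>lborel)" for S
  have mU: "m S + m T = m (S \<union> T)" if [measurable]: "S \<in> sets borel" "T \<in> sets borel" and "S \<inter> T = {}" for S T
  proof -
    have "m (S \<union> T) = (\<integral>\<^sup>+v. indicator S v * ennreal (norm (\<phi> v)) + indicator T v * ennreal (norm (\<phi> v)) \<partial>lborel)"
      unfolding m_def using that(3) by (intro nn_integral_cong) (auto simp: indicator_def)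
    also have "\<dots> = m S + m T" unfolding m_def by (rule nn_integral_add) measurable
    finally show ?thesis ..
  qed
  have "?c \<le> m P + m Q + ?d" "?c \<le> m P' + m Q' + ?d'"
    unfolding m_def by (rule mass_le_repelling_attracting; (fact assms)?)+
  then have "?c + ?c \<le> (m P + m Q + ?d) + (m P' + m Q' + ?d')" by (rule add_mono)
  also have "\<dots> = m ((P \<union> Q) \<union> (P' \<union> Q')) + (?d + ?d')"
    using disj by (simp add: mU[symmetric] algebra_simps)
  also have "m ((P \<union> Q) \<union> (P' \<union> Q')) \<le> ?c"
    unfolding m_def by (intro nn_integral_mono) (auto simp: indicator_def)
  finally show ?thesis using fin by (auto simp: ennreal_add_left_cancel_le less_top)
qed

text \<open>A matrix close to \<open>diag(4, 1/4)\<close> sends everything outside the narrow cone around the vertical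
  axis into the narrow cone around the horizontal axis. The slope \<open>3\<close> makes these cones and
  their rotations by \<open>\<pi>/4\<close> pairwise disjoint (any slope from \<open>1 + \<surd>2\<close> would do), and the expansion
  \<open>4\<^sup>2 > 3\<^sup>2\<close> leaves room for the perturbation.\<close>

lemma hyperbolic_maps_into_cone:
  fixes a b c d x y :: real
  assumes "\<bar>a - 4\<bar> < 1/10" "\<bar>b\<bar> < 1/10" "\<bar>c\<bar> < 1/10" "\<bar>d - 1/4\<bar> < 1/10"
    and "x \<noteq> 0 \<or> y \<noteq> 0" "\<not> 3 * \<bar>x\<bar> < \<bar>y\<bar>"
  shows "3 * \<bar>c * x + d * y\<bar> < \<bar>a * x + b * y\<bar>"
proof -
  have x: "\<bar>x\<bar> > 0" and y: "\<bar>y\<bar> \<le> 3 * \<bar>x\<bar>" using assms(5,6) by auto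
  have "\<bar>c * x\<bar> \<le> 1/10 * \<bar>x\<bar>" "\<bar>d * y\<bar> \<le> 7/20 * (3 * \<bar>x\<bar>)" "\<bar>b * y\<bar> \<le> 1/10 * (3 * \<bar>x\<bar>)"
    unfolding abs_mult using assms y by (intro mult_mono; linarith)+
  moreover have "\<bar>a * x\<bar> \<ge> 39/10 * \<bar>x\<bar>"
    unfolding abs_mult using assms by (intro mult_right_mono) linarith+
  moreover have "\<bar>c * x + d * y\<bar> \<le> \<bar>c * x\<bar> + \<bar>d * y\<bar>" by (rule abs_triangle_ineq)
  moreover have "\<bar>a * x\<bar> \<le> \<bar>a * x + b * y\<bar> + \<bar>b * y\<bar>"
    using abs_triangle_ineq[of "a * x + b * y" "- (b * y)"] by simp
  moreover have "3 * p < q"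
    if "p1 \<le> 1/10 * X" "p2 \<le> 7/20 * (3 * X)" "q2 \<le> 1/10 * (3 * X)" "39/10 * X \<le> q1"
      "p \<le> p1 + p2" "q1 \<le> q + q2" "X > 0" for p q p1 p2 q1 q2 X :: real
    using that by linarith
  ultimately show ?thesis using x by blast
qed

text \<open>The second reference matrix is the conjugate of \<open>diag(4, 1/4)\<close> by the rotation by \<open>\<pi>/4\<close>: it
  multiplies \<open>(1, 1)\<close> by \<open>4\<close> and \<open>(1, -1)\<close> by \<open>1/4\<close>.\<close>

lemma mass_le_two_hyperbolic_displacements:
  fixes A A' :: "real^2^2" and \<phi> :: "real^2 \<Rightarrow> complex"
  assumes det: "det A = 1" "det A' = 1"
    and A: "dist A (vector [vector [4, 0], vector [0, 1/4]]) < 1/40"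
    and A': "dist A' (vector [vector [17/8, 15/8], vector [15/8, 17/8]]) < 1/40"
    and \<phi>: "\<phi> \<in> borel_measurable borel" "(\<integral>\<^sup>+v. norm (\<phi> v) \<partial>lborel) < \<infinity>"
  shows "(\<integral>\<^sup>+v. norm (\<phi> v) \<partial>lborel) \<le>
     (\<integral>\<^sup>+v. norm (\<phi> (A *v v) - \<phi> v) \<partial>lborel) + (\<integral>\<^sup>+v. norm (\<phi> (A' *v v) - \<phi> v) \<partial>lborel)"
proof -
  have entry: "\<bar>C $ i $ j - D $ i $ j\<bar> < 1/40" if "dist C D < 1/40" for C D :: "real^2^2" and i j
  proof -
    have "\<bar>(C - D) $ i $ j\<bar> \<le> norm ((C - D) $ i)" by (rule component_le_norm_cart)
    also have "\<dots> \<le> norm (C - D)" by (rule Finite_Cartesian_Product.norm_nth_le)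
    finally show ?thesis using that by (simp add: dist_norm)
  qed
  note a = entry[OF A, of 1 1] entry[OF A, of 1 2] entry[OF A, of 2 1] entry[OF A, of 2 2]
  note a' = entry[OF A', of 1 1] entry[OF A', of 1 2] entry[OF A', of 2 1] entry[OF A', of 2 2]
  note mv = matrix_vector_mult_def sum_2
  have nz: "v $ 1 \<noteq> 0 \<or> v $ 2 \<noteq> 0" if "v \<noteq> 0" for v :: "real^2"
    using that by (auto simp: vec_eq_iff forall_2)
  have op: "{v :: real^2. 3 * \<bar>f v\<bar> < \<bar>g v\<bar>} \<in> sets borel"
    if "continuous_on UNIV f" "continuous_on UNIV g" for f g :: "real^2 \<Rightarrow> real"
    by (intro borel_open open_Collect_less continuous_intros that)
  show ?thesis
  proof (rule mass_le_two_displacements[where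
        P = "{v. 3 * \<bar>v $ 1\<bar> < \<bar>v $ 2\<bar>}" and Q = "{v. 3 * \<bar>v $ 2\<bar> < \<bar>v $ 1\<bar>}" and
        P' = "{v. 3 * \<bar>v $ 1 + v $ 2\<bar> < \<bar>v $ 1 - v $ 2\<bar>}" and
        Q' = "{v. 3 * \<bar>v $ 1 - v $ 2\<bar> < \<bar>v $ 1 + v $ 2\<bar>}"])
    fix v :: "real^2" assume v: "v \<noteq> 0"
    show "A *v v \<in> {v. 3 * \<bar>v $ 2\<bar> < \<bar>v $ 1\<bar>}" if "v \<notin> {v. 3 * \<bar>v $ 1\<bar> < \<bar>v $ 2\<bar>}"
      using hyperbolic_maps_into_cone[of "A$1$1" "A$1$2" "A$2$1" "A$2$2" "v$1" "v$2"]
        a nz[OF v] that by (simp add: mv)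
    \<comment> \<open>the entries \<open>?a, ?b, ?c, ?d\<close> describe \<open>A'\<close> in the coordinates \<open>?u, ?w\<close>\<close>
    let ?u = "v $ 1 + v $ 2" and ?w = "v $ 1 - v $ 2"
    let ?a = "(A'$1$1 + A'$2$1 + A'$1$2 + A'$2$2) / 2" and ?b = "(A'$1$1 + A'$2$1 - A'$1$2 - A'$2$2) / 2"
      and ?c = "(A'$1$1 - A'$2$1 + A'$1$2 - A'$2$2) / 2" and ?d = "(A'$1$1 + A'$2$2 - A'$2$1 - A'$1$2) / 2"
    have "\<bar>?a - 4\<bar> < 1/10 \<and> \<bar>?b\<bar> < 1/10 \<and> \<bar>?c\<bar> < 1/10 \<and> \<bar>?d - 1/4\<bar> < 1/10"
      using a'[unfolded vector_2 abs_less_iff] unfolding abs_less_iff by argo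
    moreover have "?u \<noteq> 0 \<or> ?w \<noteq> 0" using nz[OF v] by linarith
    ultimately have "3 * \<bar>?c * ?u + ?d * ?w\<bar> < \<bar>?a * ?u + ?b * ?w\<bar>" if "\<not> 3 * \<bar>?u\<bar> < \<bar>?w\<bar>"
      using that by (intro hyperbolic_maps_into_cone) auto
    moreover have "?a * ?u + ?b * ?w = (A' *v v) $ 1 + (A' *v v) $ 2"
      "?c * ?u + ?d * ?w = (A' *v v) $ 1 - (A' *v v) $ 2"
      by (simp_all add: mv field_simps)
    ultimately show "A' *v v \<in> {v. 3 * \<bar>v $ 1 - v $ 2\<bar> < \<bar>v $ 1 + v $ 2\<bar>}"
      if "v \<notin> {v. 3 * \<bar>v $ 1 + v $ 2\<bar> < \<bar>v $ 1 - v $ 2\<bar>}"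
      using that by simp
  next
    have "\<not> (3 * \<bar>p\<bar> < \<bar>q\<bar> \<and> 3 * \<bar>q\<bar> < \<bar>p\<bar>)" for p q :: real by linarith
    then show "{v :: real^2. 3 * \<bar>v $ 1\<bar> < \<bar>v $ 2\<bar>} \<inter> {v. 3 * \<bar>v $ 2\<bar> < \<bar>v $ 1\<bar>} = {}"
      "{v :: real^2. 3 * \<bar>v $ 1 + v $ 2\<bar> < \<bar>v $ 1 - v $ 2\<bar>} \<inter> {v. 3 * \<bar>v $ 1 - v $ 2\<bar> < \<bar>v $ 1 + v $ 2\<bar>} = {}"
      by blast+
    show "({v :: real^2. 3 * \<bar>v $ 1\<bar> < \<bar>v $ 2\<bar>} \<union> {v. 3 * \<bar>v $ 2\<bar> < \<bar>v $ 1\<bar>}) \<inter>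
      ({v. 3 * \<bar>v $ 1 + v $ 2\<bar> < \<bar>v $ 1 - v $ 2\<bar>} \<union> {v. 3 * \<bar>v $ 1 - v $ 2\<bar> < \<bar>v $ 1 + v $ 2\<bar>}) = {}"
    proof -
      have "\<not> (3 * \<bar>x\<bar> < \<bar>y\<bar> \<and> 3 * \<bar>x + y\<bar> < \<bar>x - y\<bar>)"
        "\<not> (3 * \<bar>x\<bar> < \<bar>y\<bar> \<and> 3 * \<bar>x - y\<bar> < \<bar>x + y\<bar>)"
        "\<not> (3 * \<bar>y\<bar> < \<bar>x\<bar> \<and> 3 * \<bar>x + y\<bar> < \<bar>x - y\<bar>)"
        "\<not> (3 * \<bar>y\<bar> < \<bar>x\<bar> \<and> 3 * \<bar>x - y\<bar> < \<bar>x + y\<bar>)" for x y :: real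
        by (smt (verit))+
      then show ?thesis by (auto simp: disjoint_iff)
    qed
  qed (use assms in \<open>auto intro!: op continuous_intros\<close>)
qed

section \<open>Haar measure on the semidirect product\<close>

locale affine_haar =
  fixes \<Gamma> :: "(real^2^2) set" and M :: "((real^2) \<times> (real^2^2)) measure"
  assumes subgroup: "subgroup \<Gamma> SL2"
    and haar: "left_haar_measure (affine_group \<Gamma>) (affine_topology \<Gamma>) M"
begin

abbreviation G where "G \<equiv> affine_group \<Gamma>"
abbreviation T where "T \<equiv> affine_topology \<Gamma>"

sublocale G: group G
  using locally_compact_group_affine[OF subgroup] by (simp add: locally_compact_group_def)

lemma carrier_G [simp]: "carrier G = UNIV \<times> \<Gamma>"
  and mult_G [simp]: "(x, A) \<otimes>\<^bsub>G\<^esub> (y, B) = (x + A *v y, A ** B)"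
  and one_G: "\<one>\<^bsub>G\<^esub> = (0, mat 1)"
  by (simp_all add: affine_group_def)

lemma one_mem [simp]: "mat 1 \<in> \<Gamma>"
  using G.one_closed by (simp add: one_G)

lemma det_mem: "A \<in> \<Gamma> \<Longrightarrow> det A = 1"
  using subgroup.subset[OF subgroup] by (auto simp: SL2_def)

lemma topspace_T [simp]: "topspace T = UNIV \<times> \<Gamma>"
  by (simp add: affine_topology_def)

lemma space_M [simp]: "space M = UNIV \<times> \<Gamma>"
  using haar unfolding left_haar_measure_def by simp

lemma sets_M: "sets M = sigma_sets (UNIV \<times> \<Gamma>) {U. openin T U}"
  using haar unfolding left_haar_measure_def borel_sets_of_def by simp

lemma openin_sets: "openin T U \<Longrightarrow> U \<in> sets M"
  by (auto simp: sets_M)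

text \<open>The Borel sets of \<open>\<real>\<^sup>2 \<rtimes> \<Gamma>\<close> are not determined fibrewise when \<open>\<Gamma>\<close> is uncountable, so
  slices do not suffice to prove that a map into the group is measurable; continuity does.\<close>

lemma continuous_measurable:
  assumes "continuous_map T T f"
  shows "f \<in> measurable M M"
proof (rule measurable_sigma_sets[OF sets_M])
  show "{U. openin T U} \<subseteq> Pow (UNIV \<times> \<Gamma>)"
    using openin_subset[of T] by auto
  show "f \<in> space M \<rightarrow> UNIV \<times> \<Gamma>"
    using continuous_map_funspace[OF assms] by simp
  show "f -` U \<inter> space M \<in> sets M" if "U \<in> {U. openin T U}" for U
    using openin_continuous_map_preimage[OF assms, of U] that
    by (intro openin_sets) (simp add: vimage_def Int_def conj_commute)
qed

lemma continuous_mult: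
  "continuous_map T T f \<Longrightarrow> continuous_map T T g \<Longrightarrow> continuous_map T T (\<lambda>x. f x \<otimes>\<^bsub>G\<^esub> g x)"
  using locally_compact_group_affine[OF subgroup]
    continuous_map_compose[OF continuous_map_pairedI[of T T f T g],
      of T "\<lambda>(x, y). x \<otimes>\<^bsub>G\<^esub> y"]
  by (simp add: locally_compact_group_def o_def)

lemma continuous_inv: "continuous_map T T (\<lambda>x. inv\<^bsub>G\<^esub> x)"
  using locally_compact_group_affine[OF subgroup] by (simp add: locally_compact_group_def)

lemma continuous_const: "s \<in> carrier G \<Longrightarrow> continuous_map T T (\<lambda>x. s)"
  by simp

lemma measurable_right_mult: "s \<in> carrier G \<Longrightarrow> (\<lambda>x. x \<otimes>\<^bsub>G\<^esub> s) \<in> measurable M M"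
  by (intro continuous_measurable continuous_mult continuous_const) auto

lemma continuous_fibre: "A \<in> \<Gamma> \<Longrightarrow> continuous_map euclidean T (\<lambda>x. (x, A))"
  by (auto simp: affine_topology_def intro!: continuous_map_pairedI)

lemma measurable_fibre [measurable]:
  assumes "A \<in> \<Gamma>"
  shows "(\<lambda>x. (x, A)) \<in> measurable borel M"
proof (rule measurable_sigma_sets[OF sets_M])
  show "{U. openin T U} \<subseteq> Pow (UNIV \<times> \<Gamma>)"
    using openin_subset[of T] by auto
  show "(\<lambda>x. (x, A)) -` U \<inter> space borel \<in> sets borel" if "U \<in> {U. openin T U}" for U
    using openin_continuous_map_preimage[OF continuous_fibre[OF assms], of U] that
    by (auto simp: vimage_def)
qed (use assms in auto)

lemma measurable_fst_M: "fst \<in> measurable M borel"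
proof (rule borel_measurableI)
  fix S :: "(real^2) set" assume "open S"
  then show "fst -` S \<inter> space M \<in> sets M"
    by (intro openin_sets)
       (auto simp: affine_topology_def vimage_fst Times_Int_Times openin_prod_Times_iff)
qed

lemma fibre_sets:
  assumes "E \<in> sets borel" "A \<in> \<Gamma>"
  shows "E \<times> {A} \<in> sets M"
proof -
  have "openin T (UNIV \<times> {A})"
    using assms by (simp add: affine_topology_def openin_prod_Times_iff)
  then have "(fst -` E \<inter> space M) \<inter> (UNIV \<times> {A}) \<in> sets M"
    using measurable_sets[OF measurable_fst_M assms(1)] openin_sets by blast
  also have "(fst -` E \<inter> space M) \<inter> (UNIV \<times> {A}) = E \<times> {A}"
    using assms by auto
  finally show ?thesis .
qed

lemma compactin_fibre: "compact K \<Longrightarrow> A \<in> \<Gamma> \<Longrightarrow> compactin T (K \<times> {A})"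
  by (simp add: affine_topology_def compactin_Times compactin_discrete_topology)

lemma left_invariant: "s \<in> carrier G \<Longrightarrow> E \<in> sets M \<Longrightarrow> emeasure M ((\<lambda>x. s \<otimes>\<^bsub>G\<^esub> x) ` E) = emeasure M E"
  using haar unfolding left_haar_measure_def by blast

lemma finite_on_compact: "compactin T K \<Longrightarrow> emeasure M K < \<infinity>"
  using haar unfolding left_haar_measure_def by blast

lemma outer_regular:
  "E \<in> sets M \<Longrightarrow> emeasure M E = (INF U\<in>{U. openin T U \<and> E \<subseteq> U}. emeasure M U)"
  using haar unfolding left_haar_measure_def by blast

lemma inner_regular:
  "openin T U \<Longrightarrow> emeasure M U = (SUP K\<in>{K. compactin T K \<and> K \<in> sets M \<and> K \<subseteq> U}. emeasure M K)"
  using haar unfolding left_haar_measure_def by blast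

text \<open>The normalisation of the Haar measure: the factor by which it exceeds Lebesgue measure on each
  fibre, see \<open>emeasure_fibre\<close>.\<close>

definition haar_const :: ennreal where
  "haar_const = emeasure M (cbox 0 One \<times> {mat 1})"

lemma haar_const_finite: "haar_const < \<infinity>"
  unfolding haar_const_def by (intro finite_on_compact compactin_fibre compact_cbox one_mem)

text \<open>Left translations by \<open>(v, 1)\<close> act on every fibre as ordinary translations, so the Haar measure
  is a multiple of Lebesgue measure on each fibre. Left translation by \<open>(0, A)\<close> carries the identity
  fibre onto the fibre over \<open>A\<close> by a matrix of determinant one, so the multiple is always the same.\<close>

lemma emeasure_fibre:
  assumes E: "E \<in> sets borel" and A: "A \<in> \<Gamma>"
  shows "emeasure M (E \<times> {A}) = haar_const * emeasure lborel E"
proof -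
  define \<mu> where "\<mu> A = distr (restrict_space M (UNIV \<times> {A})) borel fst" for A
  have em: "emeasure (\<mu> A) E = emeasure M (E \<times> {A})" if [measurable]: "E \<in> sets borel" and A: "A \<in> \<Gamma>" for A E
  proof -
    have "emeasure (\<mu> A) E
        = emeasure (restrict_space M (UNIV \<times> {A})) (fst -` E \<inter> space (restrict_space M (UNIV \<times> {A})))"
      unfolding \<mu>_def
      by (intro emeasure_distr measurable_restrict_space1 measurable_fst_M) auto
    also have "fst -` E \<inter> space (restrict_space M (UNIV \<times> {A})) = E \<times> {A}"
      using A by (auto simp: space_restrict_space)
    also have "emeasure (restrict_space M (UNIV \<times> {A})) (E \<times> {A}) = emeasure M (E \<times> {A})"
      using fibre_sets[of UNIV A] A
      by (intro emeasure_restrict_space) (auto simp: Times_Int_Times)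
    finally show ?thesis .
  qed
  have \<mu>: "\<mu> A = scale_measure (emeasure M (cbox 0 One \<times> {A})) lborel" if A: "A \<in> \<Gamma>" for A
  proof -
    have "\<mu> A = scale_measure (emeasure (\<mu> A) (cbox 0 One)) lborel"
    proof (rule translation_invariant_eq_scaled_lborel)
      show "sets (\<mu> A) = sets borel" by (simp add: \<mu>_def)
      show "emeasure (\<mu> A) K < \<infinity>" if "compact K" for K
        using finite_on_compact[OF compactin_fibre[OF that A]] that A
        by (simp add: em compact_imp_closed)
      show "distr (\<mu> A) borel ((+) v) = \<mu> A" for v
      proof (rule measure_eqI)
        fix E :: "(real^2) set" assume "E \<in> sets (distr (\<mu> A) borel ((+) v))"
        then have E[measurable]: "E \<in> sets borel" by simp
        have vim: "(+) v -` E \<in> sets borel"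
          using measurable_sets[of "(+) v" borel borel E] by auto
        have "emeasure (distr (\<mu> A) borel ((+) v)) E = emeasure (\<mu> A) ((+) v -` E)"
          by (subst emeasure_distr) (auto simp: \<mu>_def)
        also have "\<dots> = emeasure M (((+) v -` E) \<times> {A})"
          by (rule em[OF vim A])
        also have "\<dots> = emeasure M ((\<lambda>x. (v, mat 1) \<otimes>\<^bsub>G\<^esub> x) ` (((+) v -` E) \<times> {A}))"
          by (rule left_invariant[symmetric]) (use A vim in \<open>auto intro: fibre_sets\<close>)
        also have "(\<lambda>x. (v, mat 1) \<otimes>\<^bsub>G\<^esub> x) ` (((+) v -` E) \<times> {A}) = E \<times> {A}"
        proof (intro equalityI subsetI)
          fix p assume "p \<in> E \<times> {A}"
          then have "p = (v, mat 1) \<otimes>\<^bsub>G\<^esub> (fst p - v, A)" "(fst p - v, A) \<in> ((+) v -` E) \<times> {A}"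
            by auto
          then show "p \<in> (\<lambda>x. (v, mat 1) \<otimes>\<^bsub>G\<^esub> x) ` (((+) v -` E) \<times> {A})" by (rule image_eqI)
        qed auto
        finally show "emeasure (distr (\<mu> A) borel ((+) v)) E = emeasure (\<mu> A) E"
          by (simp add: em A)
      qed (simp add: \<mu>_def)
    qed
    then show ?thesis by (simp add: em A)
  qed
  \<comment> \<open>it remains to compare the fibre over \<open>A\<close> with the identity fibre\<close>
  let ?Q = "cbox 0 One :: (real^2) set"
  have cAQ: "compact ((*v) A ` ?Q)"
    by (intro compact_continuous_image compact_cbox matrix_vector_mult_linear_continuous_on)
  have meas: "(*v) A \<in> borel_measurable borel"
    by (intro borel_measurable_continuous_onI matrix_vector_mult_linear_continuous_on)
  have "inj ((*v) A)"
    using det_mem[OF A] by (simp add: inj_matrix_vector_mult invertible_det_nz)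
  then have "(*v) A -` ((*v) A ` ?Q) = ?Q" by (rule inj_vimage_image_eq)
  then have "emeasure lborel ((*v) A ` ?Q) = emeasure lborel ?Q"
    using cAQ det_mem[OF A] meas
    by (subst distr_lborel_unimodular[of A, symmetric])
       (auto simp: emeasure_distr compact_imp_closed)
  then have AQ: "emeasure lborel ((*v) A ` ?Q) = 1" by (simp add: emeasure_lborel_cbox_eq)
  have "haar_const = emeasure M ((\<lambda>x. (0, A) \<otimes>\<^bsub>G\<^esub> x) ` (?Q \<times> {mat 1}))"
    unfolding haar_const_def
    by (rule left_invariant[symmetric]) (use A in \<open>auto intro: fibre_sets\<close>)
  also have "(\<lambda>x. (0, A) \<otimes>\<^bsub>G\<^esub> x) ` (?Q \<times> {mat 1}) = ((*v) A ` ?Q) \<times> {A}"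
    by (force simp: image_iff)
  also have "emeasure M (((*v) A ` ?Q) \<times> {A}) = emeasure (\<mu> A) ((*v) A ` ?Q)"
    using cAQ A by (simp add: em compact_imp_closed)
  also have "\<dots> = emeasure M (?Q \<times> {A})"
    by (simp add: \<mu>[OF A] AQ)
  finally have "emeasure M (?Q \<times> {A}) = haar_const" ..
  then show ?thesis using em[OF E A] \<mu>[OF A] by simp
qed

lemma slice_sets: "E \<in> sets M \<Longrightarrow> A \<in> \<Gamma> \<Longrightarrow> {x. (x, A) \<in> E} \<in> sets borel"
  using measurable_sets[OF measurable_fibre] by (fastforce simp: vimage_def)

text \<open>Compact sets meet only finitely many fibres, so by regularity the values on such sets determine the
  whole Haar measure.\<close>

lemma emeasure_finite_fibres:
  assumes E: "E \<in> sets M" and F: "finite (snd ` E)"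
  shows "emeasure M E = haar_const * (\<Sum>A\<in>snd ` E. emeasure lborel {x. (x, A) \<in> E})"
proof -
  have sub: "A \<in> \<Gamma>" if "A \<in> snd ` E" for A
    using that sets.sets_into_space[OF E] by auto
  have "emeasure M E = emeasure M (\<Union>A\<in>snd ` E. {x. (x, A) \<in> E} \<times> {A})"
    by (intro arg_cong[of _ _ "emeasure M"]) force
  also have "\<dots> = (\<Sum>A\<in>snd ` E. emeasure M ({x. (x, A) \<in> E} \<times> {A}))"
    using F sub slice_sets[OF E]
    by (intro sum_emeasure[symmetric]) (auto intro!: fibre_sets simp: disjoint_family_on_def)
  also have "\<dots> = (\<Sum>A\<in>snd ` E. haar_const * emeasure lborel {x. (x, A) \<in> E})"
    using sub slice_sets[OF E] by (intro sum.cong emeasure_fibre) auto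
  finally show ?thesis by (simp add: sum_distrib_left)
qed

lemma compactin_finite_fibres: "compactin T K \<Longrightarrow> finite (snd ` K)"
  using image_compactin[of T K "discrete_topology \<Gamma>" snd]
  by (simp add: affine_topology_def continuous_map_snd compactin_discrete_topology)

text \<open>Otherwise all compact sets would be null, and by inner regularity so would the whole group.\<close>

lemma haar_const_nonzero: "haar_const \<noteq> 0"
proof
  assume "haar_const = 0"
  then have "emeasure M K = 0" if "compactin T K" "K \<in> sets M" for K
    using emeasure_finite_fibres[OF that(2) compactin_finite_fibres[OF that(1)]] by simp
  moreover have "emeasure M (space M)
      = (SUP K\<in>{K. compactin T K \<and> K \<in> sets M \<and> K \<subseteq> space M}. emeasure M K)"
    using inner_regular[OF openin_topspace] by simp
  ultimately have "emeasure M (space M) = 0"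
    by (metis (mono_tags, lifting) SUP_least bot.extremum_uniqueI bot_ennreal le_zero_eq mem_Collect_eq)
  then show False using haar unfolding left_haar_measure_def by blast
qed

section \<open>Unimodularity\<close>

lemma right_image:
  assumes s: "s \<in> carrier G" and E: "E \<subseteq> carrier G"
  shows "(\<lambda>x. x \<otimes>\<^bsub>G\<^esub> s) ` E = {x \<in> carrier G. x \<otimes>\<^bsub>G\<^esub> inv\<^bsub>G\<^esub> s \<in> E}"
proof (intro equalityI subsetI)
  fix x assume "x \<in> {x \<in> carrier G. x \<otimes>\<^bsub>G\<^esub> inv\<^bsub>G\<^esub> s \<in> E}"
  then have x: "x \<in> carrier G" "x \<otimes>\<^bsub>G\<^esub> inv\<^bsub>G\<^esub> s \<in> E" by auto
  have "x = (x \<otimes>\<^bsub>G\<^esub> inv\<^bsub>G\<^esub> s) \<otimes>\<^bsub>G\<^esub> s"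
    using s x(1) by (simp only: G.m_assoc G.inv_closed G.l_inv G.r_one)
  then show "x \<in> (\<lambda>x. x \<otimes>\<^bsub>G\<^esub> s) ` E" using x(2) by (rule image_eqI)
next
  fix x assume "x \<in> (\<lambda>x. x \<otimes>\<^bsub>G\<^esub> s) ` E"
  then obtain y where y: "x = y \<otimes>\<^bsub>G\<^esub> s" "y \<in> E" by blast
  then have "y \<in> carrier G" using E by blast
  then have "x \<otimes>\<^bsub>G\<^esub> inv\<^bsub>G\<^esub> s = y" "x \<in> carrier G"
    using s y(1) by (simp_all only: G.m_assoc G.inv_closed G.r_inv G.r_one G.m_closed)
  then show "x \<in> {x \<in> carrier G. x \<otimes>\<^bsub>G\<^esub> inv\<^bsub>G\<^esub> s \<in> E}" using y(2) by blast
qed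

lemma right_image_inv:
  assumes s: "s \<in> carrier G" and E: "E \<subseteq> carrier G"
  shows "(\<lambda>x. x \<otimes>\<^bsub>G\<^esub> inv\<^bsub>G\<^esub> s) ` ((\<lambda>x. x \<otimes>\<^bsub>G\<^esub> s) ` E) = E"
proof -
  have "x \<otimes>\<^bsub>G\<^esub> s \<otimes>\<^bsub>G\<^esub> inv\<^bsub>G\<^esub> s = x" if "x \<in> E" for x
    using s subsetD[OF E that] by (simp only: G.m_assoc G.inv_closed G.r_inv G.r_one)
  then show ?thesis by (simp add: image_comp o_def cong: image_cong_simp)
qed

lemma continuous_right_mult: "s \<in> carrier G \<Longrightarrow> continuous_map T T (\<lambda>x. x \<otimes>\<^bsub>G\<^esub> s)"
  by (intro continuous_mult continuous_const) auto

lemma right_image_sets: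
  assumes s: "s \<in> carrier G" and E: "E \<in> sets M"
  shows "(\<lambda>x. x \<otimes>\<^bsub>G\<^esub> s) ` E \<in> sets M"
proof -
  have "(\<lambda>x. x \<otimes>\<^bsub>G\<^esub> s) ` E = (\<lambda>x. x \<otimes>\<^bsub>G\<^esub> inv\<^bsub>G\<^esub> s) -` E \<inter> space M"
    using sets.sets_into_space[OF E] by (subst right_image[OF s]) auto
  then show ?thesis
    using measurable_sets[OF measurable_right_mult[OF G.inv_closed[OF s]] E] by simp
qed

lemma right_image_open:
  assumes s: "s \<in> carrier G" and U: "openin T U"
  shows "openin T ((\<lambda>x. x \<otimes>\<^bsub>G\<^esub> s) ` U)"
  using openin_continuous_map_preimage[OF continuous_right_mult[OF G.inv_closed[OF s]] U]
    openin_subset[OF U] by (subst right_image[OF s]) auto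

text \<open>Right translation by \<open>(y, D)\<close> permutes the fibres and acts on the fibre over \<open>A\<close> as the translation
  by \<open>A y\<close>, which preserves Lebesgue measure.\<close>

lemma right_invariant_finite_fibres:
  assumes s: "s \<in> carrier G" and E: "E \<in> sets M" and F: "finite (snd ` E)"
  shows "emeasure M ((\<lambda>x. x \<otimes>\<^bsub>G\<^esub> s) ` E) = emeasure M E"
proof -
  obtain y D where sD: "s = (y, D)" "D \<in> \<Gamma>" using s by auto
  have sub: "A \<in> \<Gamma>" if "A \<in> snd ` E" for A
    using that sets.sets_into_space[OF E] by auto
  have "invertible D" using det_mem[OF sD(2)] by (simp add: invertible_det_nz)
  then obtain D' where "D ** D' = mat 1" by (auto simp: invertible_def)
  then have D': "A ** D ** D' = A" for A by (metis matrix_mul_assoc matrix_mul_rid)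
  have inj: "inj_on (\<lambda>A. A ** D) X" for X by (rule inj_onI) (metis D')
  let ?E = "(\<lambda>x. x \<otimes>\<^bsub>G\<^esub> s) ` E"
  have snd: "snd ` ?E = (\<lambda>A. A ** D) ` snd ` E"
    by (simp only: image_image sD(1)) (rule image_cong, simp_all add: split_beta affine_group_def)
  have slice: "{x. (x, A ** D) \<in> ?E} = (+) (A *v y) ` {x. (x, A) \<in> E}" for A
  proof (intro equalityI subsetI)
    fix x assume "x \<in> {x. (x, A ** D) \<in> ?E}"
    then obtain z B where B: "(z, B) \<in> E" "x = z + B *v y" "A ** D = B ** D"
      by (auto simp: sD)
    moreover have "A = B" using B(3) by (metis D')
    ultimately show "x \<in> (+) (A *v y) ` {x. (x, A) \<in> E}"
      by (auto simp: image_iff add.commute)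
  qed (force simp: sD image_iff add.commute)
  have "emeasure M ?E = haar_const * (\<Sum>B\<in>snd ` ?E. emeasure lborel {x. (x, B) \<in> ?E})"
    by (rule emeasure_finite_fibres[OF right_image_sets[OF s E]]) (simp add: snd F)
  also have "\<dots> = haar_const * (\<Sum>A\<in>snd ` E. emeasure lborel {x. (x, A ** D) \<in> ?E})"
    by (simp add: snd sum.reindex[OF inj])
  also have "(\<Sum>A\<in>snd ` E. emeasure lborel {x. (x, A ** D) \<in> ?E})
      = (\<Sum>A\<in>snd ` E. emeasure lborel {x. (x, A) \<in> E})"
    unfolding slice using sub slice_sets[OF E]
    by (intro sum.cong refl emeasure_lborel_translation) auto
  finally show ?thesis by (simp add: emeasure_finite_fibres[OF E F])
qed

text \<open>Regularity passes from compact to open sets and from these to Borel sets. One inequality is enough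
  in both steps, since it also applies to the inverse translation.\<close>

lemma right_le_open:
  assumes s: "s \<in> carrier G" and U: "openin T U"
  shows "emeasure M U \<le> emeasure M ((\<lambda>x. x \<otimes>\<^bsub>G\<^esub> s) ` U)"
  unfolding inner_regular[OF U]
proof (rule SUP_least)
  fix K assume "K \<in> {K. compactin T K \<and> K \<in> sets M \<and> K \<subseteq> U}"
  then have K: "compactin T K" "K \<in> sets M" "K \<subseteq> U" by auto
  have "emeasure M K = emeasure M ((\<lambda>x. x \<otimes>\<^bsub>G\<^esub> s) ` K)"
    by (rule right_invariant_finite_fibres[OF s K(2) compactin_finite_fibres[OF K(1)], symmetric])
  also have "\<dots> \<le> emeasure M ((\<lambda>x. x \<otimes>\<^bsub>G\<^esub> s) ` U)"
    using K(3) by (intro emeasure_mono image_mono right_image_sets[OF s openin_sets[OF U]])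
  finally show "emeasure M K \<le> emeasure M ((\<lambda>x. x \<otimes>\<^bsub>G\<^esub> s) ` U)" .
qed

lemma right_le:
  assumes s: "s \<in> carrier G" and E: "E \<in> sets M"
  shows "emeasure M E \<le> emeasure M ((\<lambda>x. x \<otimes>\<^bsub>G\<^esub> s) ` E)"
  unfolding outer_regular[OF right_image_sets[OF s E]]
proof (rule INF_greatest)
  fix U assume "U \<in> {U. openin T U \<and> (\<lambda>x. x \<otimes>\<^bsub>G\<^esub> s) ` E \<subseteq> U}"
  then have U: "openin T U" "(\<lambda>x. x \<otimes>\<^bsub>G\<^esub> s) ` E \<subseteq> U" by auto
  have Uc: "U \<subseteq> carrier G" using openin_subset[OF U(1)] by simp
  have Ec: "E \<subseteq> carrier G" using sets.sets_into_space[OF E] by simp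
  let ?r = "\<lambda>x. x \<otimes>\<^bsub>G\<^esub> inv\<^bsub>G\<^esub> s"
  have V: "openin T (?r ` U)" by (rule right_image_open[OF G.inv_closed[OF s] U(1)])
  have "E \<subseteq> ?r ` U"
    using image_mono[OF U(2), of ?r] by (simp only: right_image_inv[OF s Ec])
  then have "emeasure M E \<le> emeasure M (?r ` U)"
    by (rule emeasure_mono[OF _ openin_sets[OF V]])
  also have "\<dots> \<le> emeasure M ((\<lambda>x. x \<otimes>\<^bsub>G\<^esub> s) ` (?r ` U))"
    by (rule right_le_open[OF s V])
  also have "(\<lambda>x. x \<otimes>\<^bsub>G\<^esub> s) ` (?r ` U) = U"
    using right_image_inv[OF G.inv_closed[OF s] Uc] by (simp only: G.inv_inv[OF s])
  finally show "emeasure M E \<le> emeasure M U" .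
qed

lemma right_invariant:
  assumes s: "s \<in> carrier G" and E: "E \<in> sets M"
  shows "emeasure M ((\<lambda>x. x \<otimes>\<^bsub>G\<^esub> s) ` E) = emeasure M E"
proof (rule antisym)
  have "E \<subseteq> carrier G" using sets.sets_into_space[OF E] by simp
  then show "emeasure M ((\<lambda>x. x \<otimes>\<^bsub>G\<^esub> s) ` E) \<le> emeasure M E"
    using right_le[OF G.inv_closed[OF s] right_image_sets[OF s E]]
    by (simp only: right_image_inv[OF s])
qed (rule right_le[OF s E])

text \<open>Beyond simplifying the twisted translates of functions, this settles their measurability:
  \<open>convol_measure_right\<close> integrates the modular function itself.\<close>

lemma modular_function_1:
  assumes s: "s \<in> carrier G"
  shows "modular_function G M s = 1"
  unfolding modular_function_def
proof (rule the_equality)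
  fix c :: real
  assume c: "c > 0 \<and> (\<forall>A\<in>sets M. emeasure M ((\<lambda>x. x \<otimes>\<^bsub>G\<^esub> s) ` A) = ennreal c * emeasure M A)"
  have "cbox 0 One \<times> {mat 1} \<in> sets M" by (simp add: fibre_sets)
  then have "haar_const = ennreal c * haar_const"
    using c right_invariant[OF s] unfolding haar_const_def by metis
  then show "c = 1"
    using haar_const_nonzero haar_const_finite c
    by (cases haar_const) (auto simp: ennreal_mult[symmetric])
qed (simp add: right_invariant[OF s])

section \<open>Restriction to the plane\<close>

abbreviation N where "N \<equiv> UNIV \<times> {mat 1 :: real^2^2} :: ((real^2) \<times> (real^2^2)) set"

text \<open>Although the group need not be \<open>\<sigma>\<close>-finite, integrals over the open subgroup \<open>\<real>\<^sup>2\<close> are Lebesgue integrals,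
  for which Tonelli's theorem is available.\<close>

lemma nn_integral_identity_fibre:
  assumes h[measurable]: "h \<in> borel_measurable M"
  shows "(\<integral>\<^sup>+x. indicator N x * h x \<partial>M) = haar_const * (\<integral>\<^sup>+v. h (v, mat 1) \<partial>lborel)"
proof -
  have NM: "N \<in> sets M" using fibre_sets[OF _ one_mem, of UNIV] by simp
  note emb[measurable] = measurable_fibre[OF one_mem]
  have "density M (indicator N) = scale_measure haar_const (distr lborel M (\<lambda>v. (v, mat 1)))"
    (is "?L = ?R")
  proof (rule measure_eqI)
    fix E assume "E \<in> sets ?L"
    then have E: "E \<in> sets M" by simp
    have "emeasure ?L E = emeasure M (N \<inter> E)"
      using NM E by (simp add: emeasure_density flip: indicator_inter_arith)
    also have "N \<inter> E = {v. (v, mat 1) \<in> E} \<times> {mat 1}" by auto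
    also have "emeasure M \<dots> = haar_const * emeasure lborel {v. (v, mat 1) \<in> E}"
      by (intro emeasure_fibre slice_sets E one_mem)
    also have "\<dots> = emeasure ?R E"
      using E by (simp add: emeasure_distr emb vimage_def)
    finally show "emeasure ?L E = emeasure ?R E" .
  qed simp
  then have "(\<integral>\<^sup>+x. h x \<partial>?L) = (\<integral>\<^sup>+x. h x \<partial>?R)" by simp
  moreover have "(\<integral>\<^sup>+x. h x \<partial>?L) = (\<integral>\<^sup>+x. indicator N x * h x \<partial>M)"
    using NM by (intro nn_integral_density) auto
  moreover have "(\<integral>\<^sup>+x. h x \<partial>?R) = haar_const * (\<integral>\<^sup>+v. h (v, mat 1) \<partial>lborel)"
    by (subst nn_integral_scale_measure) (simp_all add: nn_integral_distr emb)
  ultimately show ?thesis by simp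
qed

lemma fibre_integral_le:
  assumes "h \<in> borel_measurable M" and "\<And>v. h (v, mat 1) \<le> g (v, mat 1)"
  shows "haar_const * (\<integral>\<^sup>+v. h (v, mat 1) \<partial>lborel) \<le> (\<integral>\<^sup>+x. g x \<partial>M)"
  unfolding nn_integral_identity_fibre[OF assms(1), symmetric]
  by (rule nn_integral_mono) (auto simp: indicator_def assms(2))

lemma fibre_integrable:
  assumes "f \<in> L1 M"
  shows "(\<lambda>v. f (v, mat 1)) \<in> borel_measurable borel" "(\<integral>\<^sup>+v. norm (f (v, mat 1)) \<partial>lborel) < \<infinity>"
proof -
  have f: "integrable M f" using assms by (simp add: L1_def)
  then have [measurable]: "f \<in> borel_measurable M" by (rule borel_measurable_integrable)
  show "(\<lambda>v. f (v, mat 1)) \<in> borel_measurable borel"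
    by (rule measurable_compose[OF measurable_fibre[OF one_mem]]) fact
  have "haar_const * (\<integral>\<^sup>+v. norm (f (v, mat 1)) \<partial>lborel) \<le> (\<integral>\<^sup>+x. norm (f x) \<partial>M)"
    by (rule fibre_integral_le) auto
  also have "\<dots> < \<infinity>" using f by (simp add: integrable_iff_bounded)
  finally show "(\<integral>\<^sup>+v. norm (f (v, mat 1)) \<partial>lborel) < \<infinity>"
    using haar_const_nonzero by (auto simp: ennreal_mult_less_top)
qed

text \<open>Conjugation by \<open>(0, A)\<close> acts on the subgroup \<open>\<real>\<^sup>2\<close> as the matrix \<open>A\<close>. Taking \<open>s\<close> to be the inverse
  of \<open>(0, A)\<close> makes the conjugate function \<open>x \<mapsto> f (s\<^sup>-\<^sup>1 x s)\<close> equal to \<open>v \<mapsto> f (A v)\<close> there, without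
  matrix inverses.\<close>

lemma displacement_le:
  assumes f: "f \<in> L1 M" and A: "A \<in> \<Gamma>"
  defines "s \<equiv> inv\<^bsub>G\<^esub> (0, A)"
  shows "haar_const * (\<integral>\<^sup>+v. norm (f (A *v v, mat 1) - f (v, mat 1)) \<partial>lborel)
    \<le> L1_norm M (\<lambda>x. convol_measure_left G (return M s)
          (convol_measure_right G M f (return M (inv\<^bsub>G\<^esub> s))) x - f x)"
proof -
  have fm[measurable]: "f \<in> borel_measurable M"
    using f by (auto simp: L1_def)
  have A': "(0, A) \<in> carrier G" using A by simp
  have s: "s \<in> carrier G" unfolding s_def by (rule G.inv_closed[OF A'])
  have invs: "inv\<^bsub>G\<^esub> s = (0, A)" unfolding s_def by (rule G.inv_inv[OF A'])
  have right: "convol_measure_right G M f (return M (inv\<^bsub>G\<^esub> s)) x = f (x \<otimes>\<^bsub>G\<^esub> s)" if x: "x \<in> carrier G" for x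
  proof -
    have "(\<lambda>y. f (x \<otimes>\<^bsub>G\<^esub> inv\<^bsub>G\<^esub> y)) \<in> borel_measurable M"
      by (rule measurable_compose[OF continuous_measurable fm])
         (intro continuous_mult continuous_const x continuous_inv)
    then have "(\<lambda>y. f (x \<otimes>\<^bsub>G\<^esub> inv\<^bsub>G\<^esub> y) * complex_of_real (modular_function G M (inv\<^bsub>G\<^esub> y)))
        \<in> borel_measurable M"
      by (rule measurable_cong[THEN iffD1, rotated]) (metis G.inv_closed carrier_G modular_function_1 mult.right_neutral of_real_1 space_M)
    then have "convol_measure_right G M f (return M (inv\<^bsub>G\<^esub> s)) x
        = f (x \<otimes>\<^bsub>G\<^esub> inv\<^bsub>G\<^esub> (inv\<^bsub>G\<^esub> s))
            * complex_of_real (modular_function G M (inv\<^bsub>G\<^esub> (inv\<^bsub>G\<^esub> s)))"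
      unfolding convol_measure_right_def
      by (intro integral_return) (use G.inv_closed[OF s] in auto)
    then show ?thesis by (simp only: G.inv_inv[OF s] modular_function_1[OF s] of_real_1 mult_1_right)
  qed
  have conj: "convol_measure_left G (return M s) (convol_measure_right G M f (return M (inv\<^bsub>G\<^esub> s))) x
      = f ((inv\<^bsub>G\<^esub> s \<otimes>\<^bsub>G\<^esub> x) \<otimes>\<^bsub>G\<^esub> s)" if x: "x \<in> carrier G" for x
  proof -
    have "(\<lambda>y. f ((inv\<^bsub>G\<^esub> y \<otimes>\<^bsub>G\<^esub> x) \<otimes>\<^bsub>G\<^esub> s)) \<in> borel_measurable M"
      by (rule measurable_compose[OF continuous_measurable fm])
         (intro continuous_mult continuous_const x s continuous_inv)
    then have "(\<lambda>y. convol_measure_right G M f (return M (inv\<^bsub>G\<^esub> s)) (inv\<^bsub>G\<^esub> y \<otimes>\<^bsub>G\<^esub> x)) \<in> borel_measurable M"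
      by (rule measurable_cong[THEN iffD1, rotated])
         (metis G.inv_closed G.m_closed carrier_G right space_M x)
    then have "convol_measure_left G (return M s) (convol_measure_right G M f (return M (inv\<^bsub>G\<^esub> s))) x
        = convol_measure_right G M f (return M (inv\<^bsub>G\<^esub> s)) (inv\<^bsub>G\<^esub> s \<otimes>\<^bsub>G\<^esub> x)"
      unfolding convol_measure_left_def by (intro integral_return) (use s in auto)
    then show ?thesis by (simp only: right[OF G.m_closed[OF G.inv_closed[OF s] x]])
  qed
  let ?h = "\<lambda>x. f ((inv\<^bsub>G\<^esub> s \<otimes>\<^bsub>G\<^esub> x) \<otimes>\<^bsub>G\<^esub> s) - f x"
  have "(\<lambda>x. f ((inv\<^bsub>G\<^esub> s \<otimes>\<^bsub>G\<^esub> x) \<otimes>\<^bsub>G\<^esub> s)) \<in> borel_measurable M"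
    by (rule measurable_compose[OF continuous_measurable fm])
       (intro continuous_mult continuous_const continuous_map_id[unfolded id_def] G.inv_closed s)
  then have meas: "(\<lambda>x. ennreal (norm (?h x))) \<in> borel_measurable M" by measurable
  have "(inv\<^bsub>G\<^esub> s \<otimes>\<^bsub>G\<^esub> (v, mat 1)) \<otimes>\<^bsub>G\<^esub> s = (A *v v, mat 1)" for v
  proof -
    have "inv\<^bsub>G\<^esub> s \<otimes>\<^bsub>G\<^esub> (v, mat 1) = (A *v v, mat 1) \<otimes>\<^bsub>G\<^esub> (0, A)"
      by (simp add: invs)
    then have "(inv\<^bsub>G\<^esub> s \<otimes>\<^bsub>G\<^esub> (v, mat 1)) \<otimes>\<^bsub>G\<^esub> s = (A *v v, mat 1) \<otimes>\<^bsub>G\<^esub> ((0, A) \<otimes>\<^bsub>G\<^esub> s)"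
      using s A' by (simp only: ) (rule G.m_assoc, auto)
    also have "(0, A) \<otimes>\<^bsub>G\<^esub> s = \<one>\<^bsub>G\<^esub>" unfolding s_def by (rule G.r_inv[OF A'])
    finally show ?thesis by (simp add: one_G)
  qed
  then have "haar_const * (\<integral>\<^sup>+v. norm (f (A *v v, mat 1) - f (v, mat 1)) \<partial>lborel)
      = haar_const * (\<integral>\<^sup>+v. norm (?h (v, mat 1)) \<partial>lborel)" by simp
  also have "\<dots> \<le> (\<integral>\<^sup>+x. norm (?h x) \<partial>M)"
    by (rule fibre_integral_le[OF meas]) simp
  also have "\<dots> = L1_norm M (\<lambda>x. convol_measure_left G (return M s)
          (convol_measure_right G M f (return M (inv\<^bsub>G\<^esub> s))) x - f x)"
    unfolding L1_norm_def by (intro nn_integral_cong) (simp only: conj carrier_G space_M)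
  finally show ?thesis .
qed

definition unit_box :: "(real^2) \<times> (real^2^2) \<Rightarrow> complex" where
  "unit_box = indicator (cbox 0 One \<times> {mat 1})"

lemma unit_box_L1: "unit_box \<in> L1 M"
proof -
  let ?B = "cbox 0 One \<times> {mat 1 :: real^2^2} :: ((real^2) \<times> (real^2^2)) set"
  have B: "?B \<in> sets M" by (simp add: fibre_sets)
  have "(\<integral>\<^sup>+x. norm (unit_box x) \<partial>M) = (\<integral>\<^sup>+x. indicator ?B x \<partial>M)"
    by (intro nn_integral_cong) (auto simp: unit_box_def indicator_def)
  also have "\<dots> < \<infinity>"
    using B haar_const_finite by (simp add: haar_const_def)
  finally show ?thesis
    using B by (simp add: L1_def integrable_iff_bounded unit_box_def)
qed

text \<open>For \<open>x\<close> and the support of the second factor inside the subgroup \<open>\<real>\<^sup>2\<close>, only the values of \<open>f\<close> on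
  this subgroup contribute to the convolution.\<close>

lemma convol_unit_box_le:
  assumes f: "f \<in> L1 M"
  shows "ennreal (norm (convol G M f unit_box (v, mat 1)))
    \<le> haar_const * (\<integral>\<^sup>+w. ennreal (norm (f (w, mat 1))) * indicator (cbox 0 One) (v - w) \<partial>lborel)"
proof -
  have fm[measurable]: "f \<in> borel_measurable M"
    using f by (auto simp: L1_def)
  let ?x = "(v, mat 1)" and ?Q = "cbox 0 One :: (real^2) set"
  have x: "?x \<in> carrier G" by simp
  have coset: "y \<in> N \<and> v - fst y \<in> ?Q" if y: "y \<in> carrier G" and Q: "inv\<^bsub>G\<^esub> y \<otimes>\<^bsub>G\<^esub> ?x \<in> ?Q \<times> {mat 1}" for y
  proof -
    obtain k where k: "inv\<^bsub>G\<^esub> y \<otimes>\<^bsub>G\<^esub> ?x = (k, mat 1)" "k \<in> ?Q" using Q by auto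
    have "?x = y \<otimes>\<^bsub>G\<^esub> (inv\<^bsub>G\<^esub> y \<otimes>\<^bsub>G\<^esub> ?x)"
      using G.inv_closed[OF y] y x
      by (metis G.m_assoc G.r_inv G.l_one)
    then have "?x = y \<otimes>\<^bsub>G\<^esub> (k, mat 1)" by (simp only: k)
    then show ?thesis using k(2) by (cases y) auto
  qed
  let ?h = "\<lambda>y. ennreal (norm (f y)) * indicator ?Q (v - fst y)"
  have [measurable]: "fst \<in> measurable M borel" by (rule measurable_fst_M)
  have "ennreal (norm (convol G M f unit_box ?x)) \<le> (\<integral>\<^sup>+y. norm (f y * unit_box (inv\<^bsub>G\<^esub> y \<otimes>\<^bsub>G\<^esub> ?x)) \<partial>M)"
    unfolding convol_def by (rule norm_integral_le_nn_integral)
  also have "\<dots> \<le> (\<integral>\<^sup>+y. indicator N y * ?h y \<partial>M)"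
  proof (rule nn_integral_mono)
    fix y assume "y \<in> space M"
    then have "y \<in> carrier G" by simp
    then show "ennreal (norm (f y * unit_box (inv\<^bsub>G\<^esub> y \<otimes>\<^bsub>G\<^esub> ?x))) \<le> indicator N y * ?h y"
      using coset by (auto simp: unit_box_def indicator_def)
  qed
  also have "\<dots> = haar_const * (\<integral>\<^sup>+w. ?h (w, mat 1) \<partial>lborel)"
    by (rule nn_integral_identity_fibre) measurable
  finally show ?thesis by simp
qed

text \<open>An approximate identity must keep a definite amount of mass on \<open>\<real>\<^sup>2\<close>: the unit box function has norm
  \<open>haar_const\<close>, while the part of its convolution with \<open>f\<close> on \<open>\<real>\<^sup>2\<close> has norm at most the last summand, by
  Tonelli.\<close>

lemma haar_const_le_approximation:
  assumes f: "f \<in> L1 M"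
  shows "haar_const \<le> L1_norm M (\<lambda>x. convol G M f unit_box x - unit_box x)
    + haar_const * (haar_const * (\<integral>\<^sup>+v. norm (f (v, mat 1)) \<partial>lborel))"
proof -
  let ?Q = "cbox 0 One :: (real^2) set"
  define H where "H v = haar_const * (\<integral>\<^sup>+w. ennreal (norm (f (w, mat 1))) * indicator ?Q (v - w) \<partial>lborel)" for v
  note fm[measurable] = fibre_integrable(1)[OF f]
  have Hm[measurable]: "H \<in> borel_measurable borel" unfolding H_def by measurable
  have [measurable]: "fst \<in> measurable M borel" by (rule measurable_fst_M)
  \<comment> \<open>The convolution need not be measurable on the whole group, so its upper bound \<open>H\<close> takes its
     place; the truncated difference \<open>d\<close> is a measurable lower bound for the error.\<close>
  define d where "d v = indicator ?Q v - H v" for v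
  have dm[measurable]: "d \<in> borel_measurable borel" unfolding d_def by measurable
  have lQ: "emeasure lborel ?Q = 1" by (simp add: emeasure_lborel_cbox_eq)
  have Q1: "(\<integral>\<^sup>+v. indicator ?Q (v - w) \<partial>lborel) = 1" for w
  proof -
    have "(\<integral>\<^sup>+v. indicator ?Q (v - w) \<partial>lborel) = (\<integral>\<^sup>+v. indicator ?Q (- w + v) \<partial>lborel)"
      by simp
    also have "\<dots> = (\<integral>\<^sup>+v. indicator ?Q v \<partial>distr lborel borel ((+) (- w)))"
      by (subst nn_integral_distr) auto
    finally show ?thesis by (simp add: lborel_distr_plus lQ)
  qed
  have "(\<integral>\<^sup>+v. H v \<partial>lborel)
      = haar_const * (\<integral>\<^sup>+v. (\<integral>\<^sup>+w. ennreal (norm (f (w, mat 1))) * indicator ?Q (v - w) \<partial>lborel) \<partial>lborel)"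
    unfolding H_def by (rule nn_integral_cmult) measurable
  also have "(\<integral>\<^sup>+v. (\<integral>\<^sup>+w. ennreal (norm (f (w, mat 1))) * indicator ?Q (v - w) \<partial>lborel) \<partial>lborel)
      = (\<integral>\<^sup>+w. (\<integral>\<^sup>+v. ennreal (norm (f (w, mat 1))) * indicator ?Q (v - w) \<partial>lborel) \<partial>lborel)"
    by (rule lborel_pair.Fubini') measurable
  also have "\<dots> = (\<integral>\<^sup>+w. ennreal (norm (f (w, mat 1))) * (\<integral>\<^sup>+v. indicator ?Q (v - w) \<partial>lborel) \<partial>lborel)"
    by (intro nn_integral_cong nn_integral_cmult) measurable
  also have "\<dots> = (\<integral>\<^sup>+w. norm (f (w, mat 1)) \<partial>lborel)"
    by (simp only: Q1 mult_1_right)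
  finally have H: "(\<integral>\<^sup>+v. H v \<partial>lborel) = haar_const * (\<integral>\<^sup>+v. norm (f (v, mat 1)) \<partial>lborel)" .
  have diff_add: "a \<le> (a - b) + b" for a b :: ennreal
    by (metis add_increasing diff_add_cancel_ennreal linear order_refl zero_le)
  have "1 = (\<integral>\<^sup>+v. indicator ?Q v \<partial>lborel)" by (simp add: lQ)
  also have "\<dots> \<le> (\<integral>\<^sup>+v. d v + H v \<partial>lborel)"
    unfolding d_def by (intro nn_integral_mono diff_add)
  also have "\<dots> = (\<integral>\<^sup>+v. d v \<partial>lborel) + haar_const * (\<integral>\<^sup>+v. norm (f (v, mat 1)) \<partial>lborel)"
    by (subst nn_integral_add) (auto simp: H)
  finally have "haar_const * 1 \<le> haar_const * ((\<integral>\<^sup>+v. d v \<partial>lborel) + haar_const * (\<integral>\<^sup>+v. norm (f (v, mat 1)) \<partial>lborel))"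
    by (rule mult_left_mono) simp
  also have "\<dots> = haar_const * (\<integral>\<^sup>+v. d (fst (v, mat 1 :: real^2^2)) \<partial>lborel) + haar_const * (haar_const * (\<integral>\<^sup>+v. norm (f (v, mat 1)) \<partial>lborel))"
    by (simp add: distrib_left)
  also have "haar_const * (\<integral>\<^sup>+v. d (fst (v, mat 1 :: real^2^2)) \<partial>lborel)
      \<le> (\<integral>\<^sup>+x. norm (convol G M f unit_box x - unit_box x) \<partial>M)"
  proof (rule fibre_integral_le)
    show "(\<lambda>x. d (fst x)) \<in> borel_measurable M" by measurable
    fix v
    let ?c = "convol G M f unit_box (v, mat 1)" and ?u = "unit_box (v, mat 1)"
    have "indicator ?Q v = ennreal (norm ?u)" by (simp add: unit_box_def indicator_def)
    also have "\<dots> \<le> ennreal (norm (?c - ?u) + norm ?c)"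
      by (rule ennreal_leI) (metis add.commute norm_minus_commute norm_triangle_sub)
    also have "\<dots> = ennreal (norm (?c - ?u)) + ennreal (norm ?c)" by simp
    also have "\<dots> \<le> ennreal (norm (?c - ?u)) + H v"
      unfolding H_def by (intro add_left_mono convol_unit_box_le f)
    finally show "d (fst (v, mat 1 :: real^2^2)) \<le> ennreal (norm (?c - ?u))"
      unfolding d_def by (simp add: ennreal_minus_le_iff add.commute split: split_indicator)
  qed
  finally show ?thesis by (simp add: L1_norm_def)
qed

end

section \<open>Density and the conclusion\<close>

lemma dense_approximation:
  assumes "(top_of_set (carrier SL2)) closure_of \<Gamma> = carrier SL2" "det D = 1" "r > 0"
  obtains A where "A \<in> \<Gamma>" "dist A D < r"
proof -
  have "D \<in> (top_of_set (carrier SL2)) closure_of \<Gamma>" using assms by (simp add: SL2_def)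
  moreover have "openin (top_of_set (carrier SL2)) (carrier SL2 \<inter> ball D r)"
    by (simp add: openin_open_Int)
  moreover have "D \<in> carrier SL2 \<inter> ball D r" using assms by (simp add: SL2_def)
  ultimately obtain A where "A \<in> \<Gamma>" "A \<in> carrier SL2 \<inter> ball D r"
    unfolding in_closure_of by blast
  then show ?thesis using that by (simp add: dist_commute)
qed

theorem mainTheorem3:
  fixes \<Gamma> :: "(real^2^2) set"
  assumes "subgroup \<Gamma> SL2"
    and "(top_of_set (carrier SL2)) closure_of \<Gamma> = carrier SL2"
  shows "\<not> qsin (affine_group \<Gamma>) (affine_topology \<Gamma>)"
proof
  assume "qsin (affine_group \<Gamma>) (affine_topology \<Gamma>)"
  then obtain M and e :: "((real^2) \<times> (real^2^2) \<Rightarrow> complex) \<Rightarrow> (real^2) \<times> (real^2^2) \<Rightarrow> complex" and F where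
    haar: "left_haar_measure (affine_group \<Gamma>) (affine_topology \<Gamma>) M" and
    bai: "bounded_approximate_identity (affine_group \<Gamma>) M e F" and
    inv: "asymptotically_inner_invariant (affine_group \<Gamma>) M e F"
    unfolding qsin_def by blast
  interpret affine_haar \<Gamma> M by (rule affine_haar.intro) fact+
  obtain A where A: "A \<in> \<Gamma>" "dist A (vector [vector [4, 0], vector [0, 1/4]]) < 1/40"
    using dense_approximation[OF assms(2), of "vector [vector [4, 0], vector [0, 1/4]]" "1/40"]
    by (auto simp: det_2)
  obtain A' where A': "A' \<in> \<Gamma>" "dist A' (vector [vector [17/8, 15/8], vector [15/8, 17/8]]) < 1/40"
    using dense_approximation[OF assms(2), of "vector [vector [17/8, 15/8], vector [15/8, 17/8]]" "1/40"]
    by (auto simp: det_2)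
  define disp where "disp B i = L1_norm M (\<lambda>x. convol_measure_left G (return M (inv\<^bsub>G\<^esub> (0, B)))
      (convol_measure_right G M (e i) (return M (inv\<^bsub>G\<^esub> (inv\<^bsub>G\<^esub> (0, B))))) x - e i x)" for B i
  define err where "err i = L1_norm M (\<lambda>x. convol G M (e i) unit_box x - unit_box x)" for i
  have L1: "e i \<in> L1 M" for i
    using bai by (simp add: bounded_approximate_identity_def)
  have bound: "haar_const \<le> err i + haar_const * (disp A i + disp A' i)" for i
  proof -
    have "haar_const * (\<integral>\<^sup>+v. norm (e i (v, mat 1)) \<partial>lborel)
        \<le> haar_const * ((\<integral>\<^sup>+v. norm (e i (A *v v, mat 1) - e i (v, mat 1)) \<partial>lborel)
            + (\<integral>\<^sup>+v. norm (e i (A' *v v, mat 1) - e i (v, mat 1)) \<partial>lborel))"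
      by (intro mult_left_mono mass_le_two_hyperbolic_displacements fibre_integrable L1 det_mem A A') simp
    also have "\<dots> \<le> disp A i + disp A' i"
      unfolding distrib_left disp_def by (intro add_mono displacement_le L1 A A')
    finally have "haar_const * (haar_const * (\<integral>\<^sup>+v. norm (e i (v, mat 1)) \<partial>lborel))
        \<le> haar_const * (disp A i + disp A' i)"
      by (rule mult_left_mono) simp
    then show ?thesis
      using haar_const_le_approximation[OF L1, of i] unfolding err_def
      by (meson add_left_mono order_trans)
  qed
  have disp: "(disp B \<longlongrightarrow> 0) F" if "B \<in> \<Gamma>" for B
  proof -
    have "inv\<^bsub>G\<^esub> (0, B) \<in> carrier G" by (rule G.inv_closed) (simp add: that)
    from bspec[OF inv[unfolded asymptotically_inner_invariant_def] this]
    show ?thesis unfolding disp_def .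
  qed
  have "(err \<longlongrightarrow> 0) F"
    using bai unit_box_L1 unfolding bounded_approximate_identity_def err_def by blast
  then have "((\<lambda>i. err i + haar_const * (disp A i + disp A' i)) \<longlongrightarrow> 0 + haar_const * (0 + 0)) F"
    using haar_const_finite
    by (intro tendsto_add ennreal_tendsto_cmult disp A A') auto
  then have "haar_const \<le> 0 + haar_const * (0 + 0)"
    by (rule tendsto_lowerbound) (use bai bound in \<open>auto simp: bounded_approximate_identity_def\<close>)
  then show False using haar_const_nonzero by simp
qed

end
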